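(* Fix $\alpha>0$ and for each integer $n\ge 2$ consider the continuous-time $M/M/n$ queue with arrival rate $\lambda_n=n-n^{1-\alpha}$ and service rate $1$. Let $\pi_{n,t}$ be the queue length distribution (distribution of the number of customers) at time $t$ and $\nu_n$ the stationary distribution. For $\varepsilon>0$ let $\tau_{mix}(\varepsilon)=\min\{t\ge0:\chi(\pi_{n,t},\nu_n)\le\varepsilon\}$. (i) If $\alpha\ge1$, then $\tau_{mix}(\varepsilon)\le 4n^{2\alpha-1}\log\left(\frac{\chi(\pi_{n,0},\nu_n)}{\varepsilon}\right)$. (ii) If $\alpha\in(1/2,1)$, then $\tau_{mix}(\varepsilon)\le 4C_n^{-1}n^{2\alpha-1}\log\left(\frac{\chi(\pi_{n,0},\nu_n)}{\varepsilon}\right)$ for some $C_n>0$ such that $\lim_{n\to\infty}C_n=1$. (iii) If $\alpha\in(0,1/2)$, then $\tau_{mix}(\varepsilon)\le D_n^{-1}\log\left(\frac{\chi(\pi_{n,0},\nu_n)}{\varepsilon}\right)$ for some $D_n>0$ such that $\lim_{n\to\infty}D_n=1/25$. (iv) If $\alpha=1/2$ and $n\ge110$, then $\tau_{mix}(\varepsilon)\le H_n^{-1}\log\left(\frac{\chi(\pi_{n,0},\nu_n)}{\varepsilon}\right)$ for some $H_n>\frac1{10861}$ with $\lim_{n\to\infty}H_n=\frac1{1781}$.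
   Context: The $M/M/n$ queue with arrival rate $\lambda$ and service rate $1$ is the continuous-time birth-and-death Markov chain on $\mathbb Z_{\ge0}$ (state = number of customers) with birth rate $\lambda$ in every state and death rate $\min\{n,q\}$ in state $q$. For $0<\lambda<n$ it has a unique stationary distribution. For probability distributions $P,Q$ on a countable set $S$ with $P$ absolutely continuous with respect to $Q$, $\chi^2(P,Q)=\sum_{x\in S}\frac{(P(x)-Q(x))^2}{Q(x)}$ and $\chi(P,Q)=\sqrt{\chi^2(P,Q)}$. Logarithms are natural.
   Formalization: The bounds are stated for 0 < ε ≤ χ(π_{n,0},ν_n) < ∞: for ε > χ(π_{n,0},ν_n) the mixing time is 0 while the logarithm is negative, so the displayed inequality fails; for infinite χ(π_{n,0},ν_n) the right side is infinite. *)

theory Defs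
  imports "HOL-Probability.Probability"
begin

(* chi2_div P Q is infinite if P is not absolutely continuous with respect to Q or if the series
   diverges: in ennreal, a / 0 is infinite for a > 0, while 0 / 0 = 0. *)
definition chi2_div :: "'a pmf \<Rightarrow> 'a pmf \<Rightarrow> ennreal" where
  "chi2_div P Q =
     (\<integral>\<^sup>+ x. ennreal ((pmf P x - pmf Q x)\<^sup>2) / ennreal (pmf Q x) \<partial>count_space UNIV)"

definition chi_div :: "'a pmf \<Rightarrow> 'a pmf \<Rightarrow> ennreal" where
  "chi_div P Q =
     (if chi2_div P Q = \<infinity> then \<infinity> else ennreal (sqrt (enn2real (chi2_div P Q))))"

(* Transition functions of continuous-time Markov chains: K t x is the law at time t of the chain
   started in x, and Q is the matrix of transition rates, i.e. the (one-sided) derivative of the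
   transition probabilities at time 0. If Q is conservative with bounded entries then Q determines
   K on nonnegative times; K is unconstrained at negative times. *)
definition markov_semigroup :: "('a \<Rightarrow> 'a \<Rightarrow> real) \<Rightarrow> (real \<Rightarrow> 'a \<Rightarrow> 'a pmf) \<Rightarrow> bool" where
  "markov_semigroup Q K \<longleftrightarrow>
     (\<forall>x. K 0 x = return_pmf x) \<and>
     (\<forall>s t x. 0 \<le> s \<longrightarrow> 0 \<le> t \<longrightarrow> K (s + t) x = bind_pmf (K s x) (K t)) \<and>
     (\<forall>x y. ((\<lambda>t. pmf (K t x) y) has_real_derivative Q x y) (at 0 within {0..}))"

definition law_at :: "(real \<Rightarrow> 'a \<Rightarrow> 'a pmf) \<Rightarrow> 'a pmf \<Rightarrow> real \<Rightarrow> 'a pmf" where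
  "law_at K \<mu> t = bind_pmf \<mu> (K t)"

definition stationary :: "(real \<Rightarrow> 'a \<Rightarrow> 'a pmf) \<Rightarrow> 'a pmf \<Rightarrow> bool" where
  "stationary K \<nu> \<longleftrightarrow> (\<forall>t\<ge>0. law_at K \<nu> t = \<nu>)"

definition is_mixing_time :: "(real \<Rightarrow> 'a pmf) \<Rightarrow> 'a pmf \<Rightarrow> real \<Rightarrow> real \<Rightarrow> bool" where
  "is_mixing_time \<pi> \<nu> \<epsilon> \<tau> \<longleftrightarrow>
     (0 \<le> \<tau> \<and> chi_div (\<pi> \<tau>) \<nu> \<le> ennreal \<epsilon>) \<and>
     (\<forall>t. 0 \<le> t \<and> chi_div (\<pi> t) \<nu> \<le> ennreal \<epsilon> \<longrightarrow> \<tau> \<le> t)"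

definition mmn_rate :: "nat \<Rightarrow> real \<Rightarrow> nat \<Rightarrow> nat \<Rightarrow> real" where
  "mmn_rate n l i j =
     (if j = Suc i then l
      else if i = Suc j then real (min n i)
      else if i = j then - (l + real (min n i))
      else 0)"

definition arrival :: "real \<Rightarrow> nat \<Rightarrow> real" where
  "arrival \<alpha> n = real n - real n powr (1 - \<alpha>)"

end

theory Submission
  imports Defs
begin

text \<open>
  For a birth-death chain with detailed balance, the density \<open>f = \<pi>\<^sub>t / \<nu>\<close> solves \<open>f' = L f\<close>, and
  the variance of \<open>f\<close> under \<open>\<nu>\<close>, which is the squared chi-distance, decreases at twice the Dirichlet
  form. By Chen's variational formula the spectral gap is at least \<open>\<gamma>\<close> as soon as there are weights
  \<open>u > 0\<close> with \<open>d (i + 1) + b i - b (i + 1) * u (i + 1) / u i - d i * u (i - 1) / u i \<ge> \<gamma>\<close> for all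
  \<open>i\<close>, where \<open>b\<close> and \<open>d\<close> are the birth and death rates. For \<open>\<alpha> \<ge> 1\<close> the geometric weights of ratio
  \<open>sqrt (n / \<lambda>)\<close> give the gap \<open>(sqrt n - sqrt \<lambda>)\<^sup>2\<close>. For \<open>\<alpha> < 1\<close> the weights are constant below a
  window of width \<open>sqrt n\<close> under \<open>n\<close> and geometric above it, with ratio \<open>1 + \<delta>\<close> where \<open>\<delta>\<close> is
  \<open>(n - \<lambda>) / (2 * n)\<close> for \<open>\<alpha> > 1 / 2\<close>, \<open>1 / (2 * (n - \<lambda>))\<close> for \<open>\<alpha> < 1 / 2\<close>, and
  \<open>1 / (4 * sqrt n)\<close> for \<open>\<alpha> = 1 / 2\<close>.
\<close>

section \<open>A Poincare inequality for partial sums\<close>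

text \<open>Both sides run over the triples with \<open>i \<le> k < j \<le> J\<close>. Grouping by
  \<open>k\<close> collects at each edge all pairs of states that it separates.\<close>

lemma sum_triangle_swap:
  fixes X :: "nat \<Rightarrow> nat \<Rightarrow> nat \<Rightarrow> 'a :: comm_monoid_add"
  shows "(\<Sum>j\<le>J. \<Sum>i<j. \<Sum>k=i..<j. X i j k) = (\<Sum>k<J. \<Sum>i\<le>k. \<Sum>j=Suc k..J. X i j k)"
proof (induction J)
  case (Suc J)
  have "(\<Sum>i\<le>J. \<Sum>k=i..<Suc J. X i (Suc J) k) = (\<Sum>k\<le>J. \<Sum>i\<le>k. X i (Suc J) k)"
    unfolding sum.Sigma[OF finite_atMost ballI[OF finite_atLeastLessThan]]
      sum.Sigma[OF finite_atMost ballI[OF finite_atMost]] 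
    by (rule sum.reindex_bij_witness[of _ "\<lambda>(k, i). (i, k)" "\<lambda>(i, k). (k, i)"]) auto
  then show ?case
    using Suc by (simp add: lessThan_Suc_atMost sum.distrib flip: atMost_Suc lessThan_Suc)
      (simp add: lessThan_Suc_atMost[symmetric] sum.distrib add_ac)
qed auto

text \<open>Lagrange's identity. The weights need not have total mass 1, so it applies to a
  truncated law, and the differences of \<open>f\<close> can then be split along the path from
  \<open>i\<close> to \<open>j\<close>.\<close>

lemma variance_as_double_sum:
  fixes v f :: "nat \<Rightarrow> real"
  shows "(\<Sum>i\<le>J. v i) * (\<Sum>i\<le>J. v i * (f i)\<^sup>2) - (\<Sum>i\<le>J. v i * f i)\<^sup>2 =
         (\<Sum>j\<le>J. \<Sum>i<j. v i * v j * (f j - f i)\<^sup>2)"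
proof (induction J)
  case (Suc J)
  have "(\<Sum>i\<le>J. v i * v (Suc J) * (f (Suc J) - f i)\<^sup>2) =
      v (Suc J) * (f (Suc J))\<^sup>2 * (\<Sum>i\<le>J. v i) - 2 * v (Suc J) * f (Suc J) * (\<Sum>i\<le>J. v i * f i)
      + v (Suc J) * (\<Sum>i\<le>J. v i * (f i)\<^sup>2)"
    unfolding sum_distrib_left sum.distrib[symmetric] sum_subtractf[symmetric]
    by (intro sum.cong) (auto simp: algebra_simps power2_eq_square)
  with Suc show ?case
    by (simp add: lessThan_Suc_atMost) (simp add: algebra_simps power2_eq_square)
qed (simp add: power2_eq_square)

lemma weighted_cauchy_schwarz:
  fixes a u :: "'i \<Rightarrow> real"
  assumes "\<And>k. k \<in> A \<Longrightarrow> u k > 0"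
  shows "(\<Sum>k\<in>A. a k)\<^sup>2 \<le> (\<Sum>k\<in>A. u k) * (\<Sum>k\<in>A. (a k)\<^sup>2 / u k)"
proof -
  have "(\<Sum>k\<in>A. sqrt (u k) * (a k / sqrt (u k)))\<^sup>2 \<le>
      (\<Sum>k\<in>A. (sqrt (u k))\<^sup>2) * (\<Sum>k\<in>A. (a k / sqrt (u k))\<^sup>2)"
    by (rule Cauchy_Schwarz_ineq_sum)
  moreover have "(\<Sum>k\<in>A. sqrt (u k) * (a k / sqrt (u k))) = (\<Sum>k\<in>A. a k)"
    using assms by (intro sum.cong) force+
  moreover have "(\<Sum>k\<in>A. (sqrt (u k))\<^sup>2) = (\<Sum>k\<in>A. u k)"
    using assms by (intro sum.cong) (auto intro: less_imp_le)
  moreover have "(\<Sum>k\<in>A. (a k / sqrt (u k))\<^sup>2) = (\<Sum>k\<in>A. (a k)\<^sup>2 / u k)"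
    using assms by (intro sum.cong) (auto simp: power_divide intro: less_imp_le)
  ultimately show ?thesis by simp
qed

text \<open>Chen's variational bound for the spectral gap. Cauchy-Schwarz with weights \<open>u\<close> reduces the
  double sum to increments of \<open>\<psi>\<close>, the image of the partial sums of \<open>u\<close> under minus the generator;
  by detailed balance the sum of \<open>v j * \<psi> j\<close> telescopes. Working with finite sums avoids any
  integrability of \<open>\<psi>\<close>.\<close>

lemma poincare_partial_sums:
  fixes b d u v f :: "nat \<Rightarrow> real" and \<gamma> :: real
  assumes u: "\<And>i. u i > 0" and v: "\<And>i. v i \<ge> 0" and mass: "(\<Sum>i\<le>J. v i) \<le> 1"
    and b: "\<And>i. b i \<ge> 0" and d0: "d 0 = 0"
    and balance: "\<And>i. v (Suc i) * d (Suc i) = v i * b i"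
    and gap: "\<And>i. \<gamma> * u i \<le> d (Suc i) * u i - b (Suc i) * u (Suc i) - d i * u (i - 1) + b i * u i"
    and "\<gamma> \<ge> 0"
  shows "\<gamma> * ((\<Sum>i\<le>J. v i) * (\<Sum>i\<le>J. v i * (f i)\<^sup>2) - (\<Sum>i\<le>J. v i * f i)\<^sup>2)
         \<le> (\<Sum>k<J. v k * b k * (f (Suc k) - f k)\<^sup>2)"
proof -
  define \<psi> where "\<psi> i = d i * u (i - 1) - b i * u i" for i
  define N where "N i = (\<Sum>j\<le>i. v j)" for i
  define e where "e k = (f (Suc k) - f k)\<^sup>2 / u k" for k
  have e: "e k \<ge> 0" for k using u[of k] by (simp add: e_def)
  have psi: "\<gamma> * (\<Sum>k=i..<j. u k) \<le> \<psi> j - \<psi> i" if "i \<le> j" for i j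
  proof -
    have "\<gamma> * (\<Sum>k=i..<j. u k) \<le> (\<Sum>k=i..<j. \<psi> (Suc k) - \<psi> k)"
      unfolding sum_distrib_left using gap by (intro sum_mono) (auto simp: \<psi>_def algebra_simps)
    also have "\<dots> = \<psi> j - \<psi> i" using that by (rule sum_Suc_diff')
    finally show ?thesis .
  qed
  have term_bound: "\<gamma> * (v i * v j * (f j - f i)\<^sup>2) \<le> (\<Sum>k=i..<j. v i * v j * (\<psi> j - \<psi> i) * e k)"
    if "i < j" for i j
  proof -
    have "f j - f i = (\<Sum>k=i..<j. f (Suc k) - f k)"
      using that by (simp add: sum_Suc_diff')
    then have "(f j - f i)\<^sup>2 \<le> (\<Sum>k=i..<j. u k) * (\<Sum>k=i..<j. e k)"
      unfolding e_def using weighted_cauchy_schwarz[of "{i..<j}" u "\<lambda>k. f (Suc k) - f k"] u by simp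
    then have "\<gamma> * (f j - f i)\<^sup>2 \<le> (\<gamma> * (\<Sum>k=i..<j. u k)) * (\<Sum>k=i..<j. e k)"
      using \<open>\<gamma> \<ge> 0\<close> by (simp add: mult_left_mono mult.assoc)
    also have "\<dots> \<le> (\<psi> j - \<psi> i) * (\<Sum>k=i..<j. e k)"
      using psi[of i j] that e by (intro mult_right_mono) (auto intro: sum_nonneg)
    finally have "v i * v j * (\<gamma> * (f j - f i)\<^sup>2) \<le> v i * v j * ((\<psi> j - \<psi> i) * (\<Sum>k=i..<j. e k))"
      using v by (intro mult_left_mono) auto
    then show ?thesis by (simp add: sum_distrib_left mult_ac)
  qed
  \<comment> \<open>By \<open>balance\<close> each death term cancels the birth term of the state
    below; what survives is the term of the edge from \<open>k\<close> to
    \<open>k + 1\<close>.\<close>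
  have low: "(\<Sum>i\<le>k. v i * \<psi> i) = - (v k * b k * u k)" for k
    by (induction k) (use balance in \<open>auto simp: \<psi>_def d0 algebra_simps\<close>)
  have high: "(\<Sum>j=Suc k..J. v j * \<psi> j) = v k * b k * u k - v J * b J * u J" if "k < J" for k
  proof -
    have "(\<Sum>i\<le>J. v i * \<psi> i) = (\<Sum>i\<le>k. v i * \<psi> i) + (\<Sum>j=Suc k..J. v j * \<psi> j)"
      using that by (subst sum.union_disjoint[symmetric]) (auto intro: sum.cong)
    then show ?thesis unfolding low by simp
  qed
  have mass_split: "(\<Sum>j=Suc k..J. v j) = N J - N k" if "k < J" for k
  proof -
    have "(\<Sum>i\<le>J. v i) = (\<Sum>i\<le>k. v i) + (\<Sum>j=Suc k..J. v j)"
      using that by (subst sum.union_disjoint[symmetric]) (auto intro: sum.cong)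
    then show ?thesis unfolding N_def by simp
  qed
  have inner: "(\<Sum>i\<le>k. \<Sum>j=Suc k..J. v i * v j * (\<psi> j - \<psi> i)) \<le> v k * b k * u k" if "k < J" for k
  proof -
    have "(\<Sum>i\<le>k. \<Sum>j=Suc k..J. v i * v j * (\<psi> j - \<psi> i)) =
        (\<Sum>i\<le>k. v i) * (\<Sum>j=Suc k..J. v j * \<psi> j) - (\<Sum>i\<le>k. v i * \<psi> i) * (\<Sum>j=Suc k..J. v j)"
      unfolding sum_product sum_subtractf[symmetric] by (intro sum.cong) (auto simp: algebra_simps)
    \<comment> \<open>The two products with \<open>N k\<close> cancel. Truncation at
      \<open>J\<close> leaves a boundary term of favourable sign, which is dropped next.\<close>
    also have "\<dots> = N J * (v k * b k * u k) - N k * (v J * b J * u J)"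
      unfolding low high[OF that] mass_split[OF that] by (simp add: N_def algebra_simps)
    also have "\<dots> \<le> 1 * (v k * b k * u k) - 0"
      using mass v b u by (intro diff_mono mult_right_mono mult_nonneg_nonneg)
        (auto simp: N_def intro: sum_nonneg less_imp_le)
    finally show ?thesis by simp
  qed
  have "\<gamma> * ((\<Sum>i\<le>J. v i) * (\<Sum>i\<le>J. v i * (f i)\<^sup>2) - (\<Sum>i\<le>J. v i * f i)\<^sup>2)
      \<le> (\<Sum>j\<le>J. \<Sum>i<j. \<Sum>k=i..<j. v i * v j * (\<psi> j - \<psi> i) * e k)"
    unfolding variance_as_double_sum[of v J f] sum_distrib_left[of \<gamma>]
    by (intro sum_mono) (use term_bound in \<open>auto simp: sum_distrib_left\<close>)
  also have "\<dots> = (\<Sum>k<J. (\<Sum>i\<le>k. \<Sum>j=Suc k..J. v i * v j * (\<psi> j - \<psi> i)) * e k)"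
    unfolding sum_triangle_swap sum_distrib_right ..
  also have "\<dots> \<le> (\<Sum>k<J. v k * b k * u k * e k)"
    using inner e by (intro sum_mono mult_right_mono) auto
  also have "\<dots> = (\<Sum>k<J. v k * b k * (f (Suc k) - f k)\<^sup>2)"
    using u by (intro sum.cong) (auto simp: e_def less_imp_neq[symmetric])
  finally show ?thesis .
qed

section \<open>Birth-death semigroups\<close>

text \<open>Only the component started in \<open>x\<close> is kept from the mixture. Applied to a
  stationary mixture, this bounds integrals against \<open>f x\<close> by multiples of integrals
  against the stationary law.\<close>

lemma integral_bind_pmf_ge:
  fixes g :: "'b \<Rightarrow> real"
  assumes g: "\<And>z. 0 \<le> g z" "\<And>z. g z \<le> B"
  shows "pmf p x * (\<integral>z. g z \<partial>measure_pmf (f x)) \<le> (\<integral>z. g z \<partial>measure_pmf (bind_pmf p f))"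
proof -
  define G where "G y = (\<integral>z. g z \<partial>measure_pmf (f y))" for y
  have intg: "integrable (measure_pmf r) g" for r
    using g by (intro measure_pmf.integrable_const_bound[where B = B]) auto
  have G: "0 \<le> G y" "G y \<le> B" for y
    unfolding G_def using g intg by (auto intro!: integral_nonneg_AE measure_pmf.integral_le_const)
  have "pmf p x * G x = (\<integral>y. indicator {x} y * G x \<partial>measure_pmf p)"
    by (simp add: pmf.rep_eq)
  also have "\<dots> \<le> (\<integral>y. G y \<partial>measure_pmf p)"
    using G by (intro integral_mono measure_pmf.integrable_const_bound[where B = B])
      (auto split: split_indicator intro: order_trans[OF G(1) G(2)])
  finally have le: "pmf p x * G x \<le> (\<integral>y. G y \<partial>measure_pmf p)" .
  have "ennreal (\<integral>y. G y \<partial>measure_pmf p) = (\<integral>\<^sup>+y. ennreal (G y) \<partial>measure_pmf p)"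
    using G by (intro nn_integral_eq_integral[symmetric] measure_pmf.integrable_const_bound[where B = B]) auto
  moreover have "ennreal (\<integral>z. g z \<partial>measure_pmf r) = (\<integral>\<^sup>+z. ennreal (g z) \<partial>measure_pmf r)" for r
    using g intg by (intro nn_integral_eq_integral[symmetric]) auto
  ultimately have "ennreal (\<integral>y. G y \<partial>measure_pmf p) = ennreal (\<integral>z. g z \<partial>measure_pmf (bind_pmf p f))"
    by (simp add: G_def)
  then have "(\<integral>y. G y \<partial>measure_pmf p) = (\<integral>z. g z \<partial>measure_pmf (bind_pmf p f))"
    using g G by (subst (asm) ennreal_inj) (auto intro!: integral_nonneg_AE)
  with le show ?thesis unfolding G_def by simp
qed

lemma pmf_bind_ge: "pmf p x * pmf (f x) y \<le> pmf (bind_pmf p f) y"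
  using integral_bind_pmf_ge[of "indicator {y}" 1 p x f]
  by (simp add: indicator_le_1 pmf.rep_eq)

text \<open>Writing the increment as an average over starting states lets bounds that are uniform in
  the state pass to an arbitrary law.\<close>

lemma pmf_bind_diff:
  "pmf (bind_pmf p f) y - pmf p y = (\<integral>z. pmf (f z) y - of_bool (z = y) \<partial>measure_pmf p)"
proof -
  have "pmf p y = (\<integral>z. of_bool (z = y) \<partial>measure_pmf p)"
    using integral_measure_pmf_real[of "{y}" p "\<lambda>z. of_bool (z = y)"] by auto
  then show ?thesis
    unfolding pmf_bind
    by (subst Bochner_Integration.integral_diff)
      (auto intro!: measure_pmf.integrable_const_bound[where B = 1] simp: pmf_le_1)
qed

lemma sums_integral_pmf_nat:
  fixes p :: "nat pmf" and g :: "nat \<Rightarrow> real"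
  assumes "\<And>x. \<bar>g x\<bar> \<le> B"
  shows "(\<lambda>x. pmf p x * g x) sums (\<integral>x. g x \<partial>measure_pmf p)"
proof -
  have "integrable (measure_pmf p) g"
    using assms by (intro measure_pmf.integrable_const_bound[where B = B]) auto
  then have "integrable (count_space UNIV) (\<lambda>x. pmf p x * g x)"
    by (subst (asm) measure_pmf_eq_density) (subst (asm) integrable_real_density, auto)
  from sums_integral_count_space_nat[OF this] show ?thesis
    by (subst measure_pmf_eq_density) (subst integral_real_density, auto)
qed

lemma pmf_nat_sums_1: "pmf (p :: nat pmf) sums 1"
  using sums_integral_pmf_nat[of "\<lambda>_. 1" 1 p] by simp

section \<open>Birth-death rates and short-time bounds\<close>

definition bd_rate :: "(nat \<Rightarrow> real) \<Rightarrow> (nat \<Rightarrow> real) \<Rightarrow> nat \<Rightarrow> nat \<Rightarrow> real" where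
  "bd_rate b d i j =
     (if j = Suc i then b i else if i = Suc j then d i else if i = j then - (b i + d i) else 0)"

text \<open>The bound \<open>q\<close> on the exit rates makes the generator bounded and is the
  source of all estimates uniform in the state. Derivatives are given at time 0 only; those at later
  times are derived in \<open>forward_equation\<close>.\<close>

locale birth_death_semigroup =
  fixes b d :: "nat \<Rightarrow> real" and q :: real
    and K :: "real \<Rightarrow> nat \<Rightarrow> nat pmf" and \<nu> :: "nat pmf"
  assumes semigroup: "markov_semigroup (bd_rate b d) K"
    and stationary: "stationary K \<nu>"
    and b_pos: "b i > 0" and d_0: "d 0 = 0" and d_pos: "d (Suc i) > 0"
    and rate_le: "b i + d i \<le> q"
begin

lemma K_0: "K 0 x = return_pmf x"
  and K_add: "0 \<le> s \<Longrightarrow> 0 \<le> t \<Longrightarrow> K (s + t) x = bind_pmf (K s x) (K t)"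
  and K_deriv: "((\<lambda>t. pmf (K t x) y) has_real_derivative bd_rate b d x y) (at 0 within {0..})"
  using semigroup unfolding markov_semigroup_def by auto

lemma bind_stationary: "0 \<le> t \<Longrightarrow> bind_pmf \<nu> (K t) = \<nu>"
  using stationary unfolding stationary_def law_at_def by auto

lemma b_nonneg: "0 \<le> b i" and d_nonneg: "0 \<le> d i"
  using b_pos[of i] d_pos[of "i - 1"] d_0 by (cases i; force)+

lemma q_nonneg: "0 \<le> q"
  using rate_le[of 0] b_nonneg[of 0] d_nonneg[of 0] by linarith

lemma abs_bd_rate_le: "\<bar>bd_rate b d x y\<bar> \<le> q"
  using rate_le[of x] b_nonneg[of x] d_nonneg[of x] q_nonneg by (auto simp: bd_rate_def)

lemma increment_rate: "((\<lambda>h. (pmf (K h x) y - of_bool (x = y)) / h) \<longlongrightarrow> bd_rate b d x y) (at_right 0)"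
proof -
  have "((\<lambda>h. (pmf (K h x) y - of_bool (x = y)) / h) \<longlongrightarrow> bd_rate b d x y) (at 0 within {0..})"
    using K_deriv[of x y] by (simp add: has_field_derivative_iff K_0 indicator_def of_bool_def)
  then show ?thesis
    by (rule tendsto_within_subset) auto
qed

text \<open>Being in \<open>x\<close> at each of the times \<open>s, 2 * s, ..., m * s\<close> is
  one way of being there at the end.\<close>

lemma K_power_le: "0 \<le> s \<Longrightarrow> pmf (K s x) x ^ m \<le> pmf (K (real m * s) x) x"
proof (induction m)
  case (Suc m)
  have "pmf (K s x) x ^ Suc m \<le> pmf (K s x) x * pmf (K (real m * s) x) x"
    using Suc by (simp add: mult_left_mono)
  also have "\<dots> \<le> pmf (bind_pmf (K s x) (K (real m * s))) x"
    by (rule pmf_bind_ge)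
  also have "\<dots> = pmf (K (real (Suc m) * s) x) x"
    using Suc.prems by (subst K_add[symmetric]) (auto simp: algebra_simps)
  finally show ?case .
qed (simp add: K_0)

text \<open>Bernoulli's inequality turns the derivative at \<open>0\<close> into a bound for all times and states, which
  dominates the difference quotients in the limits below.\<close>

lemma stay_prob_ge:
  assumes "0 \<le> t"
  shows "1 - q * t \<le> pmf (K t x) x"
proof (cases "t = 0")
  case False
  with assms have t: "t > 0" by simp
  have "1 - q * t - e \<le> pmf (K t x) x" if e: "e > 0" for e
  proof -
    \<comment> \<open>The slack makes \<open>- c\<close> strictly smaller than the derivative at 0,
      as the limit argument requires; over the whole time \<open>t\<close> it costs exactly
      \<open>e\<close>.\<close>
    define c where "c = q + e / t"
    have c: "c > 0" using e t q_nonneg by (simp add: c_def add_nonneg_pos)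
    have "bd_rate b d x x > - c"
    proof -
      have "e / t > 0" using e t by simp
      then show ?thesis using abs_bd_rate_le[of x x] by (simp add: c_def abs_le_iff)
    qed
    from order_tendstoD(1)[OF increment_rate this]
    have "\<forall>\<^sub>F h in at_right 0. pmf (K h x) x \<ge> 1 - c * h"
      by (rule eventually_mono[OF eventually_conj[OF _ eventually_at_right_less[of 0]]])
        (auto simp: field_simps)
    moreover have "filterlim (\<lambda>m. t / real m) (at_right 0) sequentially"
      using t by real_asymp
    ultimately have "\<forall>\<^sub>F m in sequentially. pmf (K (t / real m) x) x \<ge> 1 - c * (t / real m)"
      by (rule eventually_compose_filterlim)
    \<comment> \<open>This keeps the base \<open>1 - c * (t / m)\<close> nonnegative, for
      Bernoulli's inequality and for the monotonicity of the power.\<close>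
    moreover have "\<forall>\<^sub>F m in sequentially. c * (t / real m) \<le> 1"
      using t c by real_asymp
    ultimately obtain m where m: "m > 0" "pmf (K (t / real m) x) x \<ge> 1 - c * (t / real m)"
        "c * (t / real m) \<le> 1"
      by (metis (mono_tags, lifting) eventually_gt_at_top eventually_conj eventually_happens'
          sequentially_bot)
    have "1 + real m * (- (c * (t / real m))) \<le> (1 + - (c * (t / real m))) ^ m"
      using m by (intro Bernoulli_inequality) auto
    also have "\<dots> \<le> pmf (K (t / real m) x) x ^ m"
      using m by (intro power_mono) auto
    also have "\<dots> \<le> pmf (K t x) x"
      using K_power_le[of "t / real m" x m] m t by simp
    finally have "1 - c * t \<le> pmf (K t x) x" using m by simp
    moreover have "c * t = q * t + e" using t by (simp add: c_def field_simps)
    ultimately show ?thesis by simp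
  qed
  then have "1 - q * t \<le> pmf (K t x) x + e" if "e > 0" for e
    using that by (simp add: algebra_simps)
  then show ?thesis by (rule field_le_epsilon)
qed (simp add: K_0)

text \<open>Off the diagonal, the mass found in \<open>y\<close> is at most the mass that has left
  \<open>x\<close>.\<close>

lemma increment_bound:
  assumes "0 \<le> h"
  shows "\<bar>pmf (K h x) y - of_bool (x = y)\<bar> \<le> q * h"
proof (cases "x = y")
  case True
  then show ?thesis using stay_prob_ge[OF assms, of x] pmf_le_1[of "K h x" x] by auto
next
  case False
  have "pmf (K h x) x + pmf (K h x) y = measure (K h x) {x, y}"
    using False by (simp add: measure_measure_pmf_finite)
  also have "\<dots> \<le> 1" by simp
  finally show ?thesis using False stay_prob_ge[OF assms, of x] by simp
qed

lemma bind_increment_bound: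
  assumes "0 \<le> h"
  shows "\<bar>pmf (bind_pmf p (K h)) y - pmf p y\<bar> \<le> q * h"
proof -
  have "\<bar>\<integral>z. pmf (K h z) y - of_bool (z = y) \<partial>measure_pmf p\<bar>
      \<le> (\<integral>z. \<bar>pmf (K h z) y - of_bool (z = y)\<bar> \<partial>measure_pmf p)"
    by (rule integral_abs_bound)
  also have "\<dots> \<le> q * h"
    using increment_bound[OF assms]
    by (intro measure_pmf.integral_le_const measure_pmf.integrable_const_bound[where B = "q * h"]) auto
  finally show ?thesis unfolding pmf_bind_diff .
qed

text \<open>The semigroup property and the increment bound give the Lipschitz constant
  \<open>q\<close>. Continuity is used for the flux in the forward equation and for the attainment
  of the mixing time.\<close>

lemma continuous_on_law_at: "continuous_on {0..} (\<lambda>t. pmf (law_at K p t) y)"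
proof -
  have *: "\<bar>pmf (law_at K p t) y - pmf (law_at K p s) y\<bar> \<le> q * (t - s)" if "0 \<le> s" "s \<le> t" for s t
  proof -
    have "law_at K p (s + (t - s)) = bind_pmf (law_at K p s) (K (t - s))"
      unfolding law_at_def bind_assoc_pmf using that K_add[of s "t - s"] by (intro bind_pmf_cong) auto
    then show ?thesis using bind_increment_bound[of "t - s" "law_at K p s" y] that by simp
  qed
  have "q-lipschitz_on {0..} (\<lambda>t. pmf (law_at K p t) y)"
  proof (rule lipschitz_onI)
    fix s t :: real assume "s \<in> {0..}" "t \<in> {0..}"
    then show "dist (pmf (law_at K p s) y) (pmf (law_at K p t) y) \<le> q * dist s t"
      using *[of s t] *[of t s] by (cases "s \<le> t") (auto simp: dist_real_def abs_minus_commute)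
  qed (rule q_nonneg)
  then show ?thesis by (rule lipschitz_on_continuous_on)
qed

lemma continuous_on_K: "continuous_on {0..} (\<lambda>t. pmf (K t x) y)"
  using continuous_on_law_at[of "return_pmf x" y] by (simp add: law_at_def bind_return_pmf)

lemma K_le_stationary: "0 \<le> t \<Longrightarrow> pmf \<nu> x * pmf (K t x) y \<le> pmf \<nu> y"
  using pmf_bind_ge[of \<nu> x "K t" y] by (simp add: bind_stationary)

section \<open>The flux, the stationary law and the forward equation\<close>

definition rate_error :: "nat \<Rightarrow> real \<Rightarrow> nat \<Rightarrow> real" where
  "rate_error y h x = \<bar>(pmf (K h x) y - of_bool (x = y)) / h - bd_rate b d x y\<bar>"

lemma rate_error_bounds:
  assumes "h > 0"
  shows "0 \<le> rate_error y h x \<and> rate_error y h x \<le> 2 * q"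
proof -
  have "\<bar>(pmf (K h x) y - of_bool (x = y)) / h\<bar> \<le> q"
    using increment_bound[of h x y] assms by (simp only: abs_divide) (simp add: field_simps)
  then show ?thesis
    using abs_bd_rate_le[of x y] unfolding rate_error_def by linarith
qed

text \<open>Dominated convergence along sequences: each starting state converges by the given
  derivative, and the constant \<open>2 * q\<close> dominates.\<close>

lemma rate_error_tendsto_0: "((\<lambda>h. \<integral>x. rate_error y h x \<partial>measure_pmf \<nu>) \<longlongrightarrow> 0) (at_right 0)"
  unfolding tendsto_at_iff_sequentially comp_def
proof (intro allI impI)
  fix X :: "nat \<Rightarrow> real"
  assume X: "\<forall>i. X i \<in> {0<..} - {0}" "X \<longlonglongrightarrow> 0"
  have "(\<lambda>i. rate_error y (X i) x) \<longlonglongrightarrow> 0" for x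
  proof -
    have "(\<lambda>i. (pmf (K (X i) x) y - of_bool (x = y)) / X i) \<longlonglongrightarrow> bd_rate b d x y"
      using increment_rate[of x y] X unfolding tendsto_at_iff_sequentially comp_def by blast
    then show ?thesis
      unfolding rate_error_def by (intro tendsto_rabs_zero) (simp add: LIM_zero)
  qed
  then have "(\<lambda>i. \<integral>x. rate_error y (X i) x \<partial>measure_pmf \<nu>) \<longlonglongrightarrow> (\<integral>x. 0 \<partial>measure_pmf \<nu>)"
    using rate_error_bounds[of "X _" y] X(1)
    by (intro integral_dominated_convergence[where w = "\<lambda>_. 2 * q"]) auto
  then show "(\<lambda>i. \<integral>x. rate_error y (X i) x \<partial>measure_pmf \<nu>) \<longlonglongrightarrow> 0" by simp
qed

text \<open>\<open>flux p y\<close> is the \<open>y\<close>-th entry of the row vector \<open>p\<close> times the rate matrix.\<close>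

definition flux :: "(nat \<Rightarrow> real) \<Rightarrow> nat \<Rightarrow> real" where
  "flux p y = (if y = 0 then 0 else p (y - 1) * b (y - 1)) + p (Suc y) * d (Suc y) - p y * (b y + d y)"

text \<open>A column of the rate matrix has at most three nonzero entries, so the integral is a
  finite sum.\<close>

lemma integral_bd_rate: "(\<integral>x. bd_rate b d x y \<partial>measure_pmf p) = flux (pmf p) y"
proof (cases y)
  case 0
  have "(\<integral>x. bd_rate b d x y \<partial>measure_pmf p) = (\<Sum>x\<in>{0, 1}. bd_rate b d x y * pmf p x)"
    using 0 by (intro integral_measure_pmf_real) (auto simp: bd_rate_def split: if_splits)
  then show ?thesis using 0 by (simp add: flux_def bd_rate_def algebra_simps)
next
  case (Suc k)
  have "(\<integral>x. bd_rate b d x y \<partial>measure_pmf p) = (\<Sum>x\<in>{k, Suc k, Suc (Suc k)}. bd_rate b d x y * pmf p x)"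
    using Suc by (intro integral_measure_pmf_real) (auto simp: bd_rate_def split: if_splits)
  then show ?thesis using Suc by (simp add: flux_def bd_rate_def algebra_simps)
qed

lemma increment_flux_bound:
  assumes "h > 0"
  shows "\<bar>(pmf (bind_pmf p (K h)) y - pmf p y) / h - flux (pmf p) y\<bar>
         \<le> (\<integral>x. rate_error y h x \<partial>measure_pmf p)"
proof -
  have "(pmf (bind_pmf p (K h)) y - pmf p y) / h - flux (pmf p) y =
      (\<integral>x. (pmf (K h x) y - of_bool (x = y)) / h - bd_rate b d x y \<partial>measure_pmf p)"
    unfolding pmf_bind_diff integral_bd_rate[symmetric]
    using increment_bound[of h _ y] abs_bd_rate_le[of _ y] assms
    by (subst Bochner_Integration.integral_diff)
      (auto intro!: measure_pmf.integrable_const_bound[where B = q] simp: field_simps)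
  then show ?thesis unfolding rate_error_def by (simp only: integral_abs_bound)
qed

text \<open>For \<open>\<nu>\<close> every increment vanishes, so the flux is bounded by an averaged
  error that tends to 0.\<close>

lemma flux_stationary: "flux (pmf \<nu>) y = 0"
proof -
  have "\<forall>\<^sub>F h in at_right 0. \<bar>flux (pmf \<nu>) y\<bar> \<le> (\<integral>x. rate_error y h x \<partial>measure_pmf \<nu>)"
    using eventually_at_right_less[of 0]
    by eventually_elim (use increment_flux_bound[of _ \<nu> y] bind_stationary in fastforce)
  from tendsto_lowerbound[OF rate_error_tendsto_0 this] show ?thesis by simp
qed

text \<open>Adding up the global balance equations of the states up to \<open>i\<close> leaves zero
  net flow across the edge above \<open>i\<close>.\<close>

lemma detailed_balance: "pmf \<nu> (Suc i) * d (Suc i) = pmf \<nu> i * b i"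
proof (induction i)
  case 0
  then show ?case using flux_stationary[of 0] by (simp add: flux_def d_0)
next
  case (Suc i)
  then show ?case using flux_stationary[of "Suc i"] by (simp add: flux_def algebra_simps)
qed

text \<open>Detailed balance with positive rates carries positivity between neighbours in both
  directions, and \<open>\<nu>\<close> charges some state.\<close>

lemma stationary_pos: "pmf \<nu> i > 0"
proof -
  have pos: "pmf \<nu> (Suc i) > 0 \<longleftrightarrow> pmf \<nu> i > 0" for i
  proof -
    have "pmf \<nu> (Suc i) = 0 \<longleftrightarrow> pmf \<nu> i = 0"
    proof -
      have "b i \<noteq> 0" "d (Suc i) \<noteq> 0"
        using b_pos[of i] d_pos[of i] by simp_all
      then show ?thesis using detailed_balance[of i] by (metis mult_eq_0_iff)
    qed
    then show ?thesis
      using pmf_nonneg[of \<nu> i] pmf_nonneg[of \<nu> "Suc i"] by linarith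
  qed
  have iff: "pmf \<nu> i > 0 \<longleftrightarrow> pmf \<nu> 0 > 0" for i
    by (induction i) (use pos in auto)
  obtain x where "x \<in> set_pmf \<nu>" using set_pmf_not_empty[of \<nu>] by auto
  then show ?thesis using iff[of x] iff[of i] by (auto simp: pmf_positive)
qed

text \<open>Since \<open>K r x\<close> is dominated by a multiple of \<open>\<nu>\<close> that does not depend on \<open>r\<close>, the error
  integrated against \<open>\<nu>\<close> controls left and right difference quotients at once.\<close>

lemma forward_equation:
  assumes t: "0 \<le> t"
  shows "((\<lambda>t. pmf (K t x) y) has_real_derivative flux (pmf (K t x)) y) (at t within {0..})"
proof -
  define k where "k t = pmf (K t x) y" for t
  define F where "F t = flux (pmf (K t x)) y" for t
  define \<eta> where "\<eta> h = (\<integral>z. rate_error y h z \<partial>measure_pmf \<nu>) / pmf \<nu> x" for h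
  have step: "\<bar>(k (r + h) - k r) / h - F r\<bar> \<le> \<eta> h" if "0 \<le> r" "0 < h" for r h
  proof -
    have "\<bar>(k (r + h) - k r) / h - F r\<bar> \<le> (\<integral>z. rate_error y h z \<partial>measure_pmf (K r x))"
      unfolding k_def F_def using increment_flux_bound[OF that(2), of "K r x" y] that by (simp add: K_add)
    also have "\<dots> \<le> \<eta> h"
      using integral_bind_pmf_ge[of "rate_error y h" "2 * q" \<nu> x "K r"] rate_error_bounds that
        stationary_pos[of x] by (simp add: \<eta>_def bind_stationary field_simps)
    finally show ?thesis .
  qed
  \<comment> \<open>A left quotient at \<open>t\<close> is a right quotient at \<open>s\<close>,
    hence close to \<open>F s\<close>; the second term pays for replacing \<open>F s\<close> by
    \<open>F t\<close> and vanishes by continuity.\<close>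
  have bound: "\<bar>(k s - k t) / (s - t) - F t\<bar> \<le> \<eta> \<bar>s - t\<bar> + \<bar>F s - F t\<bar>" if "0 \<le> s" "s \<noteq> t" for s
  proof (cases "s < t")
    case True
    have "(k s - k t) / (s - t) = (k t - k s) / (t - s)" using True by (simp add: field_simps)
    then show ?thesis using step[of s "t - s"] True that by simp
  next
    case False
    then show ?thesis using step[of t "s - t"] t that by simp
  qed
  have "continuous_on {0..} F"
    unfolding F_def flux_def by (cases "y = 0") (auto intro!: continuous_intros continuous_on_K)
  then have "((\<lambda>s. \<bar>F s - F t\<bar>) \<longlongrightarrow> 0) (at t within {0..})"
    using t by (auto simp: continuous_on_def intro!: tendsto_rabs_zero LIM_zero)
  moreover have "filterlim (\<lambda>s. \<bar>s - t\<bar>) (at_right 0) (at t within {0..})"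
    unfolding filterlim_at by (auto simp: eventually_at_filter intro!: tendsto_eq_intros)
  then have "((\<lambda>s. \<eta> \<bar>s - t\<bar>) \<longlongrightarrow> 0) (at t within {0..})"
    using filterlim_compose[OF tendsto_divide_zero[OF rate_error_tendsto_0]] unfolding \<eta>_def by auto
  ultimately have "((\<lambda>s. \<eta> \<bar>s - t\<bar> + \<bar>F s - F t\<bar>) \<longlongrightarrow> 0) (at t within {0..})"
    using tendsto_add_zero by blast
  then have "((\<lambda>s. (k s - k t) / (s - t) - F t) \<longlongrightarrow> 0) (at t within {0..})"
    by (rule Lim_null_comparison[rotated])
      (use bound in \<open>auto simp: eventually_at_filter\<close>)
  then show ?thesis
    unfolding has_field_derivative_iff k_def F_def by (simp add: LIM_zero_iff)
qed

end

section \<open>Decay of the chi-distance\<close>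

context birth_death_semigroup
begin

lemma stationary_neq_0 [simp]: "pmf \<nu> i \<noteq> 0"
  using stationary_pos[of i] by simp

text \<open>Starting from finitely many states keeps the density with respect to \<open>\<nu>\<close> bounded, so that its
  square can be differentiated in time term by term.\<close>

definition partial_law :: "nat \<Rightarrow> (nat \<Rightarrow> real) \<Rightarrow> real \<Rightarrow> nat \<Rightarrow> real" where
  "partial_law m w t y = (\<Sum>x\<le>m. w x * pmf (K t x) y)"

text \<open>Weights certifying a spectral gap of at least \<open>\<gamma>\<close>: Chen's condition
  multiplied by \<open>u i\<close>.\<close>

definition gap_witness :: "(nat \<Rightarrow> real) \<Rightarrow> real \<Rightarrow> bool" where
  "gap_witness u \<gamma> \<longleftrightarrow> (\<forall>i. u i > 0 \<and>
     \<gamma> * u i \<le> d (Suc i) * u i - b (Suc i) * u (Suc i) - d i * u (i - 1) + b i * u i)"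

lemma partial_law_deriv:
  assumes "0 \<le> t"
  shows "((\<lambda>t. partial_law m w t y) has_real_derivative flux (partial_law m w t) y) (at t within {0..})"
proof -
  have "flux (partial_law m w t) y = (\<Sum>x\<le>m. w x * flux (pmf (K t x)) y)"
    unfolding flux_def partial_law_def
    by (simp add: sum.distrib sum_subtractf sum_distrib_left sum_distrib_right algebra_simps)
  then show ?thesis
    unfolding partial_law_def using forward_equation[OF assms]
    by (auto intro!: DERIV_sum DERIV_cmult)
qed

lemma partial_law_le:
  assumes "\<And>x. 0 \<le> w x" "0 \<le> t"
  shows "0 \<le> partial_law m w t y" "partial_law m w t y \<le> (\<Sum>x\<le>m. w x / pmf \<nu> x) * pmf \<nu> y"
proof -
  show "0 \<le> partial_law m w t y" unfolding partial_law_def using assms by (auto intro!: sum_nonneg)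
  have "w x * pmf (K t x) y \<le> w x / pmf \<nu> x * pmf \<nu> y" for x
    using mult_left_mono[OF K_le_stationary[OF assms(2), of x y], of "w x / pmf \<nu> x"] assms(1)[of x]
      stationary_pos[of x] by (simp add: field_simps)
  then show "partial_law m w t y \<le> (\<Sum>x\<le>m. w x / pmf \<nu> x) * pmf \<nu> y"
    unfolding partial_law_def sum_distrib_right by (intro sum_mono)
qed

lemma partial_law_sums: "partial_law m w t sums (\<Sum>x\<le>m. w x)"
proof -
  have "(\<lambda>y. \<Sum>x\<le>m. w x * pmf (K t x) y) sums (\<Sum>x\<le>m. w x * 1)"
    by (intro sums_sum sums_mult pmf_nat_sums_1)
  then show ?thesis unfolding partial_law_def[abs_def] by simp
qed

section \<open>The Dirichlet form and dissipation\<close>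

text \<open>Inflow and outflow are both nonnegative, so it suffices to bound each. By detailed
  balance the inflow under \<open>M * \<nu>\<close> equals the outflow, which is at most
  \<open>q\<close> times the mass.\<close>

lemma flux_bound:
  assumes "\<And>y. 0 \<le> p y" "\<And>y. p y \<le> M * pmf \<nu> y" "0 \<le> M"
  shows "\<bar>flux p y\<bar> \<le> M * q * pmf \<nu> y"
proof -
  have le: "p y * c \<le> M * pmf \<nu> y * c" if "0 \<le> c" for y c
    using assms(2)[of y] that by (rule mult_right_mono)
  have "p y * (b y + d y) \<le> M * pmf \<nu> y * (b y + d y)"
    using le b_nonneg d_nonneg by (simp add: add_nonneg_nonneg)
  also have "\<dots> \<le> M * pmf \<nu> y * q"
    using rate_le[of y] assms(3) by (intro mult_left_mono) auto
  finally have out: "p y * (b y + d y) \<le> M * q * pmf \<nu> y" by (simp add: mult_ac)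
  have in1: "(if y = 0 then 0 else p (y - 1) * b (y - 1)) \<le> M * pmf \<nu> y * d y"
    using le[OF b_nonneg, of "y - 1" "y - 1"] detailed_balance[of "y - 1"] d_0
    by (cases y) (auto simp: mult.assoc)
  have in2: "p (Suc y) * d (Suc y) \<le> M * pmf \<nu> y * b y"
    using le[OF d_nonneg, of "Suc y" "Suc y"] detailed_balance[of y] by (simp add: mult.assoc)
  have "M * pmf \<nu> y * d y + M * pmf \<nu> y * b y \<le> M * q * pmf \<nu> y"
    using mult_left_mono[OF rate_le[of y], of "M * pmf \<nu> y"] assms(3) by (simp add: algebra_simps)
  moreover have "0 \<le> (if y = 0 then 0 else p (y - 1) * b (y - 1))" "0 \<le> p (Suc y) * d (Suc y)"
    "0 \<le> p y * (b y + d y)"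
    using assms(1) b_nonneg d_nonneg by auto
  ultimately show ?thesis using out in1 in2 unfolding flux_def by linarith
qed

text \<open>Summation by parts: detailed balance turns the flux into a difference of the edge
  currents \<open>pmf \<nu> k * b k * (f (Suc k) - f k)\<close>, and the current out of
  \<open>J\<close> remains as a boundary term.\<close>

lemma dirichlet_form_partial:
  fixes p :: "nat \<Rightarrow> real"
  defines "f \<equiv> \<lambda>y. p y / pmf \<nu> y"
  shows "(\<Sum>y\<le>J. f y * flux p y) =
    f J * (pmf \<nu> J * b J * (f (Suc J) - f J)) - (\<Sum>k<J. pmf \<nu> k * b k * (f (Suc k) - f k)\<^sup>2)"
proof -
  have p: "p y = pmf \<nu> y * f y" for y
    using stationary_pos[of y] by (simp add: f_def)
  have up: "p (Suc y) * d (Suc y) = pmf \<nu> y * b y * f (Suc y)" for y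
    unfolding p using detailed_balance[of y] by (simp add: mult_ac)
  have down: "p (Suc y) * (b (Suc y) + d (Suc y)) = pmf \<nu> (Suc y) * b (Suc y) * f (Suc y) + pmf \<nu> y * b y * f (Suc y)" for y
    using up[of y] unfolding p by (simp add: algebra_simps)
  have flux_0: "flux p 0 = pmf \<nu> 0 * b 0 * (f 1 - f 0)"
    unfolding flux_def using up[of 0] by (simp add: d_0 p[of 0] algebra_simps)
  have flux_Suc: "flux p (Suc y) = pmf \<nu> (Suc y) * b (Suc y) * (f (Suc (Suc y)) - f (Suc y)) - pmf \<nu> y * b y * (f (Suc y) - f y)" for y
    unfolding flux_def up down by (simp add: p[of y] algebra_simps)
  show ?thesis
    by (induction J) (simp_all add: flux_0 flux_Suc algebra_simps power2_eq_square)
qed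

text \<open>Twice the sum in the last claim is the time derivative of the energy, and the Poincare
  inequality bounds it. Since \<open>c\<close> is the total mass of \<open>p\<close>, energy minus
  \<open>c\<close> squared is the variance of the density.\<close>

lemma dissipation:
  assumes p: "\<And>y. 0 \<le> p y" "\<And>y. p y \<le> M * pmf \<nu> y" and "p sums c"
    and u: "gap_witness u \<gamma>" and "0 \<le> \<gamma>"
  shows "summable (\<lambda>y. (p y)\<^sup>2 / pmf \<nu> y)" "summable (\<lambda>y. p y * flux p y / pmf \<nu> y)"
    and "(\<Sum>y. p y * flux p y / pmf \<nu> y) \<le> - \<gamma> * ((\<Sum>y. (p y)\<^sup>2 / pmf \<nu> y) - c\<^sup>2)"
proof -
  define f where "f y = p y / pmf \<nu> y" for y
  have f: "0 \<le> f y" "f y \<le> M" for y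
    using p[of y] stationary_pos[of y] by (auto simp: f_def field_simps)
  have M: "0 \<le> M" using f[of 0] by linarith
  have nu: "summable (pmf \<nu>)" using pmf_nat_sums_1 by (rule sums_summable)
  have pf: "p y = pmf \<nu> y * f y" for y
    using stationary_pos[of y] by (simp add: f_def)
  have sq: "(p y)\<^sup>2 / pmf \<nu> y = pmf \<nu> y * (f y)\<^sup>2" for y
    using stationary_pos[of y] by (simp add: f_def power2_eq_square)
  have fl: "p y * flux p y / pmf \<nu> y = f y * flux p y" for y
    by (simp add: f_def)
  show s1: "summable (\<lambda>y. (p y)\<^sup>2 / pmf \<nu> y)"
    unfolding sq
  proof (rule summable_comparison_test')
    show "summable (\<lambda>y. M\<^sup>2 * pmf \<nu> y)" using nu by (rule summable_mult)
    show "norm (pmf \<nu> y * (f y)\<^sup>2) \<le> M\<^sup>2 * pmf \<nu> y" for y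
      using mult_left_mono[OF power_mono[OF f(2) f(1), of y 2] pmf_nonneg[of \<nu> y]]
      by (simp add: mult.commute)
  qed
  show s2: "summable (\<lambda>y. p y * flux p y / pmf \<nu> y)"
    unfolding fl
  proof (rule summable_comparison_test')
    show "summable (\<lambda>y. (M * (M * q)) * pmf \<nu> y)" using nu by (rule summable_mult)
    show "norm (f y * flux p y) \<le> (M * (M * q)) * pmf \<nu> y" for y
      using mult_mono[OF f(2)[of y] flux_bound[of p M y]] f(1)[of y] p M
      by (simp add: abs_mult mult_ac)
  qed
  have "(\<Sum>y\<le>J. f y * flux p y) \<le> M * q * M * pmf \<nu> J
      - \<gamma> * ((\<Sum>y\<le>J. pmf \<nu> y) * (\<Sum>y\<le>J. (p y)\<^sup>2 / pmf \<nu> y) - (\<Sum>y\<le>J. p y)\<^sup>2)" for J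
  proof -
    have "(\<Sum>y\<le>J. pmf \<nu> y) \<le> 1"
      using sum_le_suminf[OF nu, of "{..J}"] pmf_nat_sums_1[of \<nu>] by (simp add: sums_iff)
    then have "\<gamma> * ((\<Sum>i\<le>J. pmf \<nu> i) * (\<Sum>i\<le>J. pmf \<nu> i * (f i)\<^sup>2) - (\<Sum>i\<le>J. pmf \<nu> i * f i)\<^sup>2)
        \<le> (\<Sum>k<J. pmf \<nu> k * b k * (f (Suc k) - f k)\<^sup>2)"
      using u \<open>0 \<le> \<gamma>\<close> b_nonneg d_0 detailed_balance unfolding gap_witness_def
      by (intro poincare_partial_sums[where u = u and d = d]) (auto simp del: mult_cancel_left)
    \<comment> \<open>Bounded density and bounded rates make the boundary term at most a multiple of
      \<open>pmf \<nu> J\<close>, which vanishes as \<open>J\<close> grows.\<close>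
    moreover have "f J * (pmf \<nu> J * b J * (f (Suc J) - f J)) \<le> M * (pmf \<nu> J * q * M)"
    proof -
      have "b J \<le> q" using rate_le[of J] d_nonneg[of J] by linarith
      moreover have "f (Suc J) - f J \<le> M" using f[of J] f[of "Suc J"] by linarith
      ultimately have "b J * (f (Suc J) - f J) \<le> q * M"
        using M q_nonneg b_nonneg[of J]
        by (intro order_trans[OF mult_left_mono mult_right_mono]) auto
      then have "pmf \<nu> J * b J * (f (Suc J) - f J) \<le> pmf \<nu> J * q * M"
        using mult_left_mono[of "b J * (f (Suc J) - f J)" "q * M" "pmf \<nu> J"] by (simp add: mult.assoc)
      then have "f J * (pmf \<nu> J * b J * (f (Suc J) - f J)) \<le> f J * (pmf \<nu> J * q * M)"
        using f by (intro mult_left_mono) auto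
      also have "\<dots> \<le> M * (pmf \<nu> J * q * M)"
        using f M q_nonneg by (intro mult_right_mono) auto
      finally show ?thesis .
    qed
    moreover have mass: "(\<Sum>i\<le>J. pmf \<nu> i * f i) = (\<Sum>i\<le>J. p i)"
      by (simp only: pf)
    moreover have "M * (pmf \<nu> J * q * M) = M * q * M * pmf \<nu> J"
      by (simp only: mult_ac)
    moreover have "(\<Sum>y\<le>J. f y * flux p y) = f J * (pmf \<nu> J * b J * (f (Suc J) - f J))
        - (\<Sum>k<J. pmf \<nu> k * b k * (f (Suc k) - f k)\<^sup>2)"
      unfolding f_def by (rule dirichlet_form_partial)
    ultimately show ?thesis unfolding sq mass by linarith
  qed
  then have le: "(\<Sum>y\<le>J. p y * flux p y / pmf \<nu> y) \<le> M * q * M * pmf \<nu> J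
      - \<gamma> * ((\<Sum>y\<le>J. pmf \<nu> y) * (\<Sum>y\<le>J. (p y)\<^sup>2 / pmf \<nu> y) - (\<Sum>y\<le>J. p y)\<^sup>2)" for J
    unfolding fl .
  have "(\<lambda>J. \<Sum>y\<le>J. pmf \<nu> y) \<longlonglongrightarrow> 1" "(\<lambda>J. \<Sum>y\<le>J. p y) \<longlonglongrightarrow> c"
    using pmf_nat_sums_1[of \<nu>] \<open>p sums c\<close> unfolding sums_def_le .
  then have "(\<lambda>J. M * q * M * pmf \<nu> J
      - \<gamma> * ((\<Sum>y\<le>J. pmf \<nu> y) * (\<Sum>y\<le>J. (p y)\<^sup>2 / pmf \<nu> y) - (\<Sum>y\<le>J. p y)\<^sup>2))
      \<longlonglongrightarrow> M * q * M * 0 - \<gamma> * (1 * (\<Sum>y. (p y)\<^sup>2 / pmf \<nu> y) - c\<^sup>2)"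
    using summable_LIMSEQ'[OF s1] summable_LIMSEQ_zero[OF nu] by (intro tendsto_intros)
  from LIMSEQ_le[OF summable_LIMSEQ'[OF s2] this] le
  show "(\<Sum>y. p y * flux p y / pmf \<nu> y) \<le> - \<gamma> * ((\<Sum>y. (p y)\<^sup>2 / pmf \<nu> y) - c\<^sup>2)"
    by simp
qed

section \<open>Exponential decay of the chi-distance\<close>

text \<open>Gronwall's argument for the variance of the density, with rate
  \<open>2 * \<gamma>\<close>. As \<open>w\<close> is truncated at \<open>m\<close>, its mass
  \<open>c\<close> may differ from 1 and the limit law is \<open>c * \<nu>\<close>.\<close>

lemma partial_law_decay:
  fixes m :: nat
  assumes w: "\<And>x. 0 \<le> w x" and u: "gap_witness u \<gamma>" and "0 \<le> \<gamma>" and "0 \<le> t"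
  defines "c \<equiv> (\<Sum>x\<le>m. w x)"
  shows "(\<Sum>y\<le>J. (partial_law m w t y - c * pmf \<nu> y)\<^sup>2 / pmf \<nu> y)
         \<le> exp (- 2 * \<gamma> * t) * ((\<Sum>x\<le>m. (w x)\<^sup>2 / pmf \<nu> x) - c\<^sup>2)"
proof -
  define M where "M = (\<Sum>x\<le>m. w x / pmf \<nu> x)"
  have M: "0 \<le> M" unfolding M_def using w by (auto intro!: sum_nonneg)
  have pl: "0 \<le> partial_law m w t y" "partial_law m w t y \<le> M * pmf \<nu> y" if "0 \<le> t" for t y
    unfolding M_def using partial_law_le[of w, OF w that] by auto
  have sums_c: "partial_law m w t sums c" for t
    unfolding c_def by (rule partial_law_sums)
  define E where "E t = (\<Sum>y. (partial_law m w t y)\<^sup>2 / pmf \<nu> y)" for t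
  define E' where "E' t = (\<Sum>y. 2 * (partial_law m w t y * flux (partial_law m w t) y / pmf \<nu> y))" for t
  note diss = dissipation[OF pl(1) pl(2) sums_c u \<open>0 \<le> \<gamma>\<close>]
  \<comment> \<open>The energy is differentiated term by term; the flux bound makes the series of
    derivatives converge uniformly by the Weierstrass test.\<close>
  have "\<exists>g. \<forall>t\<in>{0..}. (\<lambda>y. (partial_law m w t y)\<^sup>2 / pmf \<nu> y) sums g t \<and>
      (g has_field_derivative E' t) (at t within {0..})"
  proof (rule has_field_derivative_series)
    show "((\<lambda>t. (partial_law m w t y)\<^sup>2 / pmf \<nu> y) has_field_derivative
        2 * (partial_law m w t y * flux (partial_law m w t) y / pmf \<nu> y)) (at t within {0..})"
      if "t \<in> {0..}" for t y
      using that by (intro DERIV_cong[OF DERIV_cdivide[OF DERIV_power[OF partial_law_deriv, where n = 2]]]) auto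
    show "uniform_limit {0..} (\<lambda>n t. \<Sum>y<n. 2 * (partial_law m w t y * flux (partial_law m w t) y / pmf \<nu> y))
        E' sequentially"
      unfolding E'_def
    proof (rule Weierstrass_m_test)
      fix y and t :: real assume "t \<in> {0..}"
      then have t: "0 \<le> t" by simp
      have "\<bar>partial_law m w t y * flux (partial_law m w t) y\<bar> \<le> (M * pmf \<nu> y) * (M * q * pmf \<nu> y)"
        unfolding abs_mult using pl[OF t] flux_bound[of "partial_law m w t" M y] M
        by (intro mult_mono) auto
      then show "norm (2 * (partial_law m w t y * flux (partial_law m w t) y / pmf \<nu> y))
          \<le> (2 * M * M * q) * pmf \<nu> y"
        using stationary_pos[of y] by (simp add: abs_divide field_simps)
    next
      show "summable (\<lambda>y. (2 * M * M * q) * pmf \<nu> y)"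
        using sums_summable[OF pmf_nat_sums_1] by (rule summable_mult)
    qed
    show "summable (\<lambda>y. (partial_law m w 0 y)\<^sup>2 / pmf \<nu> y)"
      by (rule diss(1)) auto
  qed auto
  then obtain g where g: "\<And>t. 0 \<le> t \<Longrightarrow> (\<lambda>y. (partial_law m w t y)\<^sup>2 / pmf \<nu> y) sums g t"
      "\<And>t. 0 \<le> t \<Longrightarrow> (g has_field_derivative E' t) (at t within {0..})"
    by auto
  have E_deriv: "(E has_field_derivative E' t) (at t within {0..})" if "0 \<le> t" for t
    by (rule has_field_derivative_transform_within[OF g(2)[OF that], of 1])
      (use that g(1) in \<open>auto simp: E_def sums_iff\<close>)
  \<comment> \<open>The integrating factor turns the differential inequality into monotonicity of
    \<open>G\<close>.\<close>
  define G where "G t = exp (2 * \<gamma> * t) * (E t - c\<^sup>2)" for t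
  have "G t \<le> G 0"
  proof (cases "t = 0")
    case False
    have "continuous_on {0..t} E"
      by (rule continuous_on_subset[of "{0..}"])
        (auto simp: continuous_on_eq_continuous_within intro: DERIV_continuous[OF E_deriv])
    then have "continuous_on {0..t} G"
      unfolding G_def by (intro continuous_intros)
    moreover have "\<exists>y. (G has_real_derivative y) (at s) \<and> y \<le> 0" if s: "0 < s" "s < t" for s
    proof -
      have "at s within {0..} = at s"
        using s by (intro at_within_interior) (auto simp: interior_real_atLeast)
      then have "(E has_real_derivative E' s) (at s)"
        using E_deriv[of s] s by simp
      then have "(G has_real_derivative exp (2 * \<gamma> * s) * (E' s + 2 * \<gamma> * (E s - c\<^sup>2))) (at s)"
        unfolding G_def[abs_def]
        by (intro DERIV_cong[OF DERIV_mult[OF DERIV_fun_exp[OF DERIV_cmult[OF DERIV_ident]] DERIV_diff[OF _ DERIV_const]]])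
          (auto simp: algebra_simps)
      moreover have "E' s + 2 * \<gamma> * (E s - c\<^sup>2) \<le> 0"
        using diss(3)[of s] suminf_mult[OF diss(2)[of s], of 2] s unfolding E'_def E_def by simp
      ultimately show ?thesis
        by (intro exI[of _ "exp (2 * \<gamma> * s) * (E' s + 2 * \<gamma> * (E s - c\<^sup>2))"]) (auto intro: mult_nonneg_nonpos)
    qed
    ultimately show ?thesis
      using False \<open>0 \<le> t\<close> by (intro DERIV_nonpos_imp_decreasing_open[of 0 t G]) auto
  qed simp
  then have decay: "E t - c\<^sup>2 \<le> exp (- 2 * \<gamma> * t) * (E 0 - c\<^sup>2)"
    by (simp add: G_def exp_minus field_simps)
  have "partial_law m w 0 y = (if y \<le> m then w y else 0)" for y
    by (simp add: partial_law_def K_0 indicator_def if_distrib sum.delta cong: if_cong)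
  then have "E 0 = (\<Sum>y. if y \<in> {..m} then (w y)\<^sup>2 / pmf \<nu> y else 0)"
    unfolding E_def by (intro suminf_cong) auto
  also have "\<dots> = (\<Sum>x\<le>m. (w x)\<^sup>2 / pmf \<nu> x)"
    by (intro sums_unique[symmetric] sums_If_finite_set) auto
  finally have E0: "E 0 = (\<Sum>x\<le>m. (w x)\<^sup>2 / pmf \<nu> x)" .
  \<comment> \<open>Expanding the square, the cross term has sum \<open>2 * c * c\<close> because
    mass is conserved, so the squared distance to \<open>c * \<nu>\<close> is the energy minus
    \<open>c\<close> squared.\<close>
  have "(\<lambda>y. (partial_law m w t y)\<^sup>2 / pmf \<nu> y - 2 * c * partial_law m w t y + c\<^sup>2 * pmf \<nu> y)
      sums (E t - 2 * c * c + c\<^sup>2 * 1)"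
    unfolding E_def using diss(1) \<open>0 \<le> t\<close> sums_c pmf_nat_sums_1
    by (intro sums_add sums_diff sums_mult summable_sums) auto
  moreover have "(partial_law m w t y)\<^sup>2 / pmf \<nu> y - 2 * c * partial_law m w t y + c\<^sup>2 * pmf \<nu> y
      = (partial_law m w t y - c * pmf \<nu> y)\<^sup>2 / pmf \<nu> y" for y
    using stationary_pos[of y] by (simp add: field_simps power2_eq_square)
  ultimately have "(\<lambda>y. (partial_law m w t y - c * pmf \<nu> y)\<^sup>2 / pmf \<nu> y) sums (E t - c\<^sup>2)"
    by (simp add: power2_eq_square)
  then have "(\<Sum>y\<le>J. (partial_law m w t y - c * pmf \<nu> y)\<^sup>2 / pmf \<nu> y) \<le> E t - c\<^sup>2"
    using sum_le_suminf[of "\<lambda>y. (partial_law m w t y - c * pmf \<nu> y)\<^sup>2 / pmf \<nu> y" "{..J}"]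
    by (simp add: sums_iff)
  then show ?thesis using decay unfolding E0 by linarith
qed

text \<open>Truncate the starting law at \<open>m\<close>, apply the decay bound and let
  \<open>m\<close> grow with \<open>J\<close> fixed.\<close>

lemma law_at_decay:
  assumes u: "gap_witness u \<gamma>" and "0 \<le> \<gamma>" and t: "0 \<le> t"
    and B: "\<And>m. (\<Sum>y\<le>m. (pmf p y - pmf \<nu> y)\<^sup>2 / pmf \<nu> y) \<le> B"
  shows "(\<Sum>y\<le>J. (pmf (law_at K p t) y - pmf \<nu> y)\<^sup>2 / pmf \<nu> y) \<le> exp (- 2 * \<gamma> * t) * B"
proof -
  define c where "c m = (\<Sum>x\<le>m. pmf p x)" for m
  have c: "c \<longlonglongrightarrow> 1"
    using pmf_nat_sums_1[of p] unfolding sums_def_le c_def[abs_def] .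
  have N: "(\<lambda>m. \<Sum>x\<le>m. pmf \<nu> x) \<longlonglongrightarrow> 1"
    using pmf_nat_sums_1[of \<nu>] unfolding sums_def_le .
  have law: "(\<lambda>m. partial_law m (pmf p) t y) \<longlonglongrightarrow> pmf (law_at K p t) y" for y
    using sums_integral_pmf_nat[of "\<lambda>x. pmf (K t x) y" 1 p]
    unfolding sums_def_le partial_law_def law_at_def pmf_bind by (simp add: pmf_le_1)
  have "(\<Sum>x\<le>m. (pmf p x)\<^sup>2 / pmf \<nu> x) =
      (\<Sum>x\<le>m. (pmf p x - pmf \<nu> x)\<^sup>2 / pmf \<nu> x) + 2 * c m - (\<Sum>x\<le>m. pmf \<nu> x)" for m
    unfolding c_def sum_distrib_left sum.distrib[symmetric] sum_subtractf[symmetric]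
    by (intro sum.cong) (simp_all add: field_simps power2_eq_square)
  then have "(\<Sum>x\<le>m. (pmf p x)\<^sup>2 / pmf \<nu> x) - (c m)\<^sup>2 \<le> B + 2 * c m - (\<Sum>x\<le>m. pmf \<nu> x) - (c m)\<^sup>2" for m
    using B[of m] by simp
  then have le: "(\<Sum>y\<le>J. (partial_law m (pmf p) t y - c m * pmf \<nu> y)\<^sup>2 / pmf \<nu> y)
      \<le> exp (- 2 * \<gamma> * t) * (B + 2 * c m - (\<Sum>x\<le>m. pmf \<nu> x) - (c m)\<^sup>2)" for m
    using partial_law_decay[of "pmf p" u \<gamma> t m J] u \<open>0 \<le> \<gamma>\<close> t unfolding c_def
    by (meson exp_ge_zero mult_left_mono order_trans pmf_nonneg)
  have lim: "(\<lambda>m. \<Sum>y\<le>J. (partial_law m (pmf p) t y - c m * pmf \<nu> y)\<^sup>2 / pmf \<nu> y)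
      \<longlonglongrightarrow> (\<Sum>y\<le>J. (pmf (law_at K p t) y - 1 * pmf \<nu> y)\<^sup>2 / pmf \<nu> y)"
    by (intro tendsto_intros law c) auto
  \<comment> \<open>Both truncated masses tend to 1, so the corrections to \<open>B\<close> cancel
    in the limit.\<close>
  have "(\<lambda>m. exp (- 2 * \<gamma> * t) * (B + 2 * c m - (\<Sum>x\<le>m. pmf \<nu> x) - (c m)\<^sup>2))
      \<longlonglongrightarrow> exp (- 2 * \<gamma> * t) * (B + 2 * 1 - 1 - 1\<^sup>2)"
    by (intro tendsto_intros c N)
  from LIMSEQ_le[OF lim this] le show ?thesis by simp
qed

end

section \<open>From partial sums to mixing times\<close>

text \<open>A series of nonnegative terms is bounded exactly when its partial sums are. This
  replaces the extended-real distance by finite real sums, which are continuous in time and pass to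
  limits.\<close>

lemma chi_div_le_iff:
  fixes P Q :: "nat pmf"
  assumes Q: "\<And>x. pmf Q x > 0" and \<epsilon>: "0 \<le> \<epsilon>"
  shows "chi_div P Q \<le> ennreal \<epsilon> \<longleftrightarrow> (\<forall>J. (\<Sum>x\<le>J. (pmf P x - pmf Q x)\<^sup>2 / pmf Q x) \<le> \<epsilon>\<^sup>2)"
proof -
  define a where "a x = (pmf P x - pmf Q x)\<^sup>2 / pmf Q x" for x
  have a: "0 \<le> a x" for x unfolding a_def by simp
  have chi2: "chi2_div P Q = (\<Sum>x. ennreal (a x))"
    unfolding chi2_div_def a_def nn_integral_count_space_nat
    using Q by (simp add: divide_ennreal)
  have "chi2_div P Q \<le> ennreal (\<epsilon>\<^sup>2) \<longleftrightarrow> (\<forall>J. (\<Sum>x\<le>J. a x) \<le> \<epsilon>\<^sup>2)"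
  proof
    assume le: "chi2_div P Q \<le> ennreal (\<epsilon>\<^sup>2)"
    show "\<forall>J. (\<Sum>x\<le>J. a x) \<le> \<epsilon>\<^sup>2"
    proof
      fix J
      have "ennreal (\<Sum>x\<le>J. a x) = (\<Sum>x\<le>J. ennreal (a x))"
        using a by (simp add: sum_ennreal)
      also have "\<dots> \<le> chi2_div P Q"
        unfolding chi2 by (intro sum_le_suminf) auto
      also note le
      finally have "ennreal (\<Sum>x\<le>J. a x) \<le> ennreal (\<epsilon>\<^sup>2)" .
      then show "(\<Sum>x\<le>J. a x) \<le> \<epsilon>\<^sup>2" by (rule iffD1[OF ennreal_le_iff, rotated]) auto
    qed
  next
    assume le: "\<forall>J. (\<Sum>x\<le>J. a x) \<le> \<epsilon>\<^sup>2"
    show "chi2_div P Q \<le> ennreal (\<epsilon>\<^sup>2)"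
      unfolding chi2 suminf_eq_SUP
    proof (rule SUP_least)
      fix n
      have "(\<Sum>x<n. ennreal (a x)) \<le> (\<Sum>x\<le>n. ennreal (a x))" by (intro sum_mono2) auto
      also have "\<dots> = ennreal (\<Sum>x\<le>n. a x)" using a by (simp add: sum_ennreal)
      also have "\<dots> \<le> ennreal (\<epsilon>\<^sup>2)" using le by (intro ennreal_leI) auto
      finally show "(\<Sum>x<n. ennreal (a x)) \<le> ennreal (\<epsilon>\<^sup>2)" .
    qed
  qed
  moreover have "chi_div P Q \<le> ennreal \<epsilon> \<longleftrightarrow> chi2_div P Q \<le> ennreal (\<epsilon>\<^sup>2)"
  proof (cases "chi2_div P Q")
    case (real r)
    then show ?thesis
      using \<epsilon> by (auto simp: chi_div_def ennreal_le_iff intro: real_le_lsqrt dest: sqrt_le_D)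
  qed (simp add: chi_div_def top_unique)
  ultimately show ?thesis unfolding a_def by simp
qed

context birth_death_semigroup
begin

text \<open>At time \<open>ln (X / \<epsilon>) / \<gamma>\<close> the decay factor is exactly the
  square of \<open>\<epsilon> / X\<close>. The minimum over times is attained because the set of
  admissible times is closed.\<close>

lemma mixing_time_le:
  assumes u: "gap_witness u \<gamma>" and \<gamma>: "0 < \<gamma>"
    and fin: "chi_div p \<nu> < \<infinity>" and \<epsilon>: "0 < \<epsilon>" "ennreal \<epsilon> \<le> chi_div p \<nu>"
  shows "\<exists>\<tau>. is_mixing_time (law_at K p) \<nu> \<epsilon> \<tau> \<and> \<tau> \<le> ln (enn2real (chi_div p \<nu>) / \<epsilon>) / \<gamma>"
proof -
  define X where "X = enn2real (chi_div p \<nu>)"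
  have chi: "chi_div p \<nu> = ennreal X"
    unfolding X_def using fin by (simp add: ennreal_enn2real_if)
  have X: "\<epsilon> \<le> X"
    using \<epsilon> unfolding chi by (metis X_def enn2real_nonneg ennreal_le_iff)
  note chi_le = chi_div_le_iff[OF stationary_pos]
  define S where "S = {t. 0 \<le> t \<and> chi_div (law_at K p t) \<nu> \<le> ennreal \<epsilon>}"
  define T where "T = ln (X / \<epsilon>) / \<gamma>"
  have T: "0 \<le> T" unfolding T_def using X \<epsilon> \<gamma> by simp
  have "(\<Sum>y\<le>J. (pmf (law_at K p T) y - pmf \<nu> y)\<^sup>2 / pmf \<nu> y) \<le> exp (- 2 * \<gamma> * T) * X\<^sup>2" for J
    using u \<gamma> T chi_le[of X p] chi X \<epsilon> by (intro law_at_decay) auto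
  moreover have "exp (- 2 * \<gamma> * T) = (\<epsilon> / X)\<^sup>2"
  proof -
    have "exp (- 2 * \<gamma> * T) = exp (- ln (X / \<epsilon>)) ^ 2"
      using \<gamma> by (simp add: T_def exp_double[symmetric])
    also have "exp (- ln (X / \<epsilon>)) = \<epsilon> / X"
      using X \<epsilon> by (simp add: exp_minus)
    finally show ?thesis .
  qed
  ultimately have "T \<in> S"
    unfolding S_def using chi_le[of \<epsilon>] T X \<epsilon> by (simp add: power_divide)
  \<comment> \<open>Each partial sum is continuous in time, so \<open>S\<close> is an intersection
    of closed sets.\<close>
  have "S = (\<Inter>J. {t \<in> {0..}. (\<Sum>y\<le>J. (pmf (law_at K p t) y - pmf \<nu> y)\<^sup>2 / pmf \<nu> y) \<in> {..\<epsilon>\<^sup>2}})"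
    unfolding S_def using chi_le[of \<epsilon>] \<epsilon> by auto
  moreover have "closed {t \<in> {0..}. (\<Sum>y\<le>J. (pmf (law_at K p t) y - pmf \<nu> y)\<^sup>2 / pmf \<nu> y) \<in> {..\<epsilon>\<^sup>2}}" for J
    by (intro continuous_closed_preimage[unfolded vimage_def Int_def, simplified mem_Collect_eq])
      (auto intro!: continuous_intros continuous_on_law_at)
  ultimately have "closed S" by auto
  moreover have "bdd_below S" unfolding S_def by (auto intro!: bdd_belowI[of _ 0])
  ultimately have "Inf S \<in> S" using \<open>T \<in> S\<close> by (intro closed_contains_Inf) auto
  moreover have "Inf S \<le> t" if "t \<in> S" for t
    using that \<open>bdd_below S\<close> by (rule cInf_lower)
  ultimately show ?thesis
    using \<open>T \<in> S\<close> unfolding is_mixing_time_def X_def[symmetric] T_def S_def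
    by (intro exI[of _ "Inf S"]) (auto simp: S_def)
qed

end

section \<open>The M/M/n queue\<close>

text \<open>Dividing Chen's condition by \<open>u i\<close> leaves only ratios of neighbouring
  weights, so the ratios can be chosen freely and multiplied up.\<close>

lemma (in birth_death_semigroup) gap_witness_ratios:
  assumes "\<And>i. \<rho> i > 0" and "\<And>i. \<gamma> \<le> d (Suc i) + b i - b (Suc i) * \<rho> i - d i / \<rho> (i - 1)"
  shows "gap_witness (\<lambda>i. \<Prod>k<i. \<rho> k) \<gamma>"
  unfolding gap_witness_def
proof (intro allI conjI)
  fix i
  define u where "u i = (\<Prod>k<i. \<rho> k)" for i
  have pos: "u i > 0" for i unfolding u_def using assms(1) by (simp add: prod_pos)
  have "d i * u (i - 1) = u i * (d i / \<rho> (i - 1))"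
    using assms(1)[of "i - 1"] by (cases i) (auto simp: d_0 u_def)
  then show "\<gamma> * u i \<le> d (Suc i) * u i - b (Suc i) * u (Suc i) - d i * u (i - 1) + b i * u i"
    using mult_left_mono[OF assms(2)[of i], of "u i"] pos[of i]
    by (simp add: u_def algebra_simps)
  show "u i > 0" by (rule pos)
qed

text \<open>\<open>\<rho> i\<close> is the ratio \<open>u (i + 1) / u i\<close> of consecutive weights. At \<open>i = 0\<close> the truncated index
  \<open>i - 1\<close> is harmless because the death rate vanishes.\<close>

definition mmn_gap :: "nat \<Rightarrow> real \<Rightarrow> real \<Rightarrow> bool" where
  "mmn_gap n l \<gamma> \<longleftrightarrow> (\<exists>\<rho>. \<forall>i. \<rho> i > 0 \<and>
     \<gamma> \<le> real (min n (Suc i)) + l - l * \<rho> i - real (min n i) / \<rho> (i - 1))"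

lemma mmn_mixing_time_le:
  assumes sg: "markov_semigroup (mmn_rate n l) K" and st: "stationary K \<nu>"
    and "0 < l" "0 < n" and gap: "mmn_gap n l \<gamma>" "0 < \<gamma>"
    and chi: "chi_div p \<nu> < \<infinity>" "0 < \<epsilon>" "ennreal \<epsilon> \<le> chi_div p \<nu>"
  shows "\<exists>\<tau>. is_mixing_time (law_at K p) \<nu> \<epsilon> \<tau> \<and> \<tau> \<le> ln (enn2real (chi_div p \<nu>) / \<epsilon>) / \<gamma>"
proof -
  have rate: "mmn_rate n l = bd_rate (\<lambda>_. l) (\<lambda>i. real (min n i))"
    by (intro ext) (simp add: mmn_rate_def bd_rate_def)
  interpret birth_death_semigroup "\<lambda>_. l" "\<lambda>i. real (min n i)" "l + real n" K \<nu>
    using sg st \<open>0 < l\<close> \<open>0 < n\<close> by unfold_locales (auto simp: rate)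
  obtain \<rho> where "\<And>i. \<rho> i > 0"
    "\<And>i. \<gamma> \<le> real (min n (Suc i)) + l - l * \<rho> i - real (min n i) / \<rho> (i - 1)"
    using gap(1) unfolding mmn_gap_def by blast
  from mixing_time_le[OF gap_witness_ratios[OF this] gap(2) chi] show ?thesis .
qed

lemma mmn_gap_mono: "mmn_gap n l \<gamma> \<Longrightarrow> \<gamma>' \<le> \<gamma> \<Longrightarrow> mmn_gap n l \<gamma>'"
  unfolding mmn_gap_def by (meson order_trans)

section \<open>Gap bounds for general arrival rates\<close>

text \<open>The ratio maximises \<open>n + l - l * \<rho> - n / \<rho>\<close>, the bound for states
  from \<open>n\<close> on. Below \<open>n\<close> the growth of the death rate by 1 per state must
  suffice, which is the last hypothesis.\<close>

lemma mmn_gap_constant_ratio: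
  assumes "0 < l" "l \<le> real n" "n > 0" "sqrt n * (sqrt n - sqrt l) \<le> 1"
  shows "mmn_gap n l ((sqrt n - sqrt l)\<^sup>2)"
  unfolding mmn_gap_def
proof (intro exI[of _ "\<lambda>_. sqrt n / sqrt l"] allI conjI)
  fix i
  have sq: "sqrt n * sqrt n = n" "sqrt l * sqrt l = l" using assms by auto
  have e1: "l * (sqrt n / sqrt l) = sqrt n * sqrt l"
    using assms sq by (simp add: field_simps)
  have e2: "x / (sqrt n / sqrt l) = x * sqrt l / sqrt n" for x
    using assms by simp
  have e3: "real n * sqrt l / sqrt n = sqrt n * sqrt l"
    using assms by (simp add: real_div_sqrt field_simps)
  show "(sqrt n - sqrt l)\<^sup>2 \<le> real (min n (Suc i)) + l - l * (sqrt n / sqrt l) - real (min n i) / (sqrt n / sqrt l)"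
  proof (cases "i < n")
    case True
    have "sqrt l / sqrt n \<le> 1" using assms by simp
    from mult_left_mono[OF this, of "real i"] have "real i * sqrt l / sqrt n \<le> real i" by simp
    moreover have "(sqrt n - sqrt l)\<^sup>2 = n + l - 2 * (sqrt n * sqrt l)"
      using sq by (simp add: power2_eq_square algebra_simps)
    ultimately show ?thesis
      using True assms(4) sq(1) unfolding e1 e2 by (simp add: min_def algebra_simps)
  next
    case False
    have "(sqrt n - sqrt l)\<^sup>2 = n + l - 2 * (sqrt n * sqrt l)"
      using sq by (simp add: power2_eq_square algebra_simps)
    then show ?thesis using False unfolding e1 e2 by (simp add: min_def e3)
  qed
qed (use assms in auto)

text \<open>The ratio is \<open>1\<close> far below \<open>n\<close>, rises linearly over a window of width \<open>sqrt n\<close>, and equals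
  \<open>1 + \<delta>\<close> from \<open>n - 1\<close> on. The slope of the ramp and the distance to \<open>n\<close> inside the window each
  cost about \<open>\<delta> * sqrt n\<close>.\<close>

lemma mmn_gap_ramp:
  assumes "0 < l" "l \<le> real n" "n > 0" "\<delta> > 0"
    and g1: "\<gamma> \<le> 1 - \<delta> * (2 * sqrt n + 1 + n * \<delta>)"
    and g2: "\<gamma> \<le> \<delta> * (n - l - l * \<delta>) / (1 + \<delta>)"
  shows "mmn_gap n l \<gamma>"
proof -
  define w where "w = sqrt (real n)"
  have w: "w > 0" "w * w = n" using \<open>n > 0\<close> by (auto simp: w_def)
  \<comment> \<open>The offset gives \<open>c (n - 1) = 1\<close>: the condition at state
    \<open>n\<close> involves the ratio at \<open>n - 1\<close> too, which must already be
    \<open>1 + \<delta>\<close>.\<close>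
  define c where "c i = max 0 (min 1 ((real i + 1 - n + w) / w))" for i
  have c: "0 \<le> c i" "c i \<le> 1" for i by (auto simp: c_def)
  have c1: "c i = 1" if "real i + 1 \<ge> n" for i
    using that w by (auto simp: c_def field_simps)
  have c_Suc: "c (Suc i) - c i \<le> 1 / w" "c i \<le> c (Suc i)" for i
  proof -
    have "(real (Suc i) + 1 - n + w) / w = (real i + 1 - n + w) / w + 1 / w"
      by (simp add: add_divide_distrib[symmetric])
    moreover have "1 / w > 0" using w by simp
    ultimately show "c (Suc i) - c i \<le> 1 / w" "c i \<le> c (Suc i)" unfolding c_def by linarith+
  qed
  have "\<gamma> \<le> real (min n (Suc i)) + l - l * (1 + \<delta> * c i) - real (min n i) / (1 + \<delta> * c (i - 1))" for i
  proof (cases "i < n")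
    case False
    then have "c i = 1" "c (i - 1) = 1" using \<open>n > 0\<close> by (auto intro!: c1)
    moreover have "\<delta> * (n - l - l * \<delta>) / (1 + \<delta>) = n + l - l * (1 + \<delta>) - n / (1 + \<delta>)"
      using \<open>\<delta> > 0\<close> by (simp add: field_simps)
    ultimately show ?thesis using False g2 by (simp add: min_def)
  next
    case True
    define c' where "c' = c (i - 1)"
    have c': "0 \<le> c'" "c' \<le> 1" using c by (auto simp: c'_def)
    have x: "0 \<le> \<delta> * c'" using c' \<open>\<delta> > 0\<close> by simp
    \<comment> \<open>With \<open>l \<le> n\<close> the left side is at most
      \<open>n * (c i - c') + (n - i) * c'\<close>. The slope costs \<open>n / w = w\<close>, and
      the distance to \<open>n\<close> inside the window is at most \<open>w + 1\<close>.\<close>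
    have "l * c i - i * c' \<le> 2 * w + 1"
    proof (cases "c i = 0")
      case True
      moreover have "0 \<le> real i * c'" using c' by simp
      ultimately show ?thesis using w(1) by (simp add: True)
    next
      case False
      have step: "c i - c' \<le> 1 / w"
        unfolding c'_def using c_Suc[of "i - 1"] w by (cases i) auto
      have "(real i + 1 - n + w) / w > 0" using False by (auto simp: c_def max_def split: if_splits)
      then have "real n - i \<le> w + 1" using w by (simp add: zero_less_divide_iff)
      then have "(real n - i) * c' \<le> (w + 1) * 1"
        using c' True w by (intro mult_mono) auto
      moreover have "real n * (c i - c') \<le> real n * (1 / w)"
        using step by (intro mult_left_mono) auto
      moreover have "real n * (1 / w) = w" using w by (simp add: field_simps)
      moreover have "l * c i \<le> real n * c i" using assms c by (intro mult_right_mono) auto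
      ultimately show ?thesis by (simp add: algebra_simps)
    qed
    then have a: "\<delta> * (l * c i - i * c') \<le> \<delta> * (2 * w + 1)"
      using \<open>\<delta> > 0\<close> by (intro mult_left_mono) auto
    have "1 / (1 + y) \<le> 1 - y + y\<^sup>2" if "0 \<le> y" for y :: real
    proof -
      have "(1 - y + y\<^sup>2) * (1 + y) = 1 + y ^ 3"
        by (simp add: power2_eq_square power3_eq_cube algebra_simps)
      then show ?thesis using that by (simp add: pos_divide_le_eq)
    qed
    from this[OF x] have "1 / (1 + \<delta> * c') \<le> 1 - \<delta> * c' + (\<delta> * c')\<^sup>2" .
    also have "\<dots> \<le> 1 - \<delta> * c' + \<delta>\<^sup>2"
      using c' \<open>\<delta> > 0\<close> by (simp add: power_mult_distrib power_le_one mult_left_le)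
    finally have "i * (1 / (1 + \<delta> * c')) \<le> i * (1 - \<delta> * c' + \<delta>\<^sup>2)"
      by (intro mult_left_mono) auto
    also have "\<dots> \<le> i - \<delta> * (i * c') + n * \<delta>\<^sup>2"
      using True by (simp add: algebra_simps mult_right_mono)
    finally have b: "i / (1 + \<delta> * c') \<le> i - \<delta> * (i * c') + n * \<delta>\<^sup>2" by simp
    have "\<gamma> \<le> 1 - \<delta> * (2 * w + 1) - n * \<delta>\<^sup>2"
      using g1 by (simp add: w_def power2_eq_square algebra_simps)
    then have "\<gamma> \<le> 1 - \<delta> * (l * c i - i * c') - n * \<delta>\<^sup>2" using a by linarith
    then show ?thesis using b True unfolding c'_def[symmetric] by (simp add: min_def algebra_simps)
  qed
  moreover have "1 + \<delta> * c i > 0" for i using c[of i] \<open>\<delta> > 0\<close> by (simp add: add_pos_nonneg)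
  ultimately show ?thesis
    unfolding mmn_gap_def by (intro exI[of _ "\<lambda>i. 1 + \<delta> * c i"]) auto
qed

text \<open>A ramp with small \<open>\<delta>\<close> always gives some positive gap. It serves the
  small \<open>n\<close> that asymptotic estimates do not reach.\<close>

lemma mmn_gap_positive:
  assumes "0 < l" "l < real n"
  shows "\<exists>\<gamma>>0. mmn_gap n l \<gamma>"
proof -
  have n: "n > 0" using assms by (cases n) auto
  define s where "s = 2 * sqrt n + 1 + n"
  \<comment> \<open>The term with \<open>s\<close> keeps the first ramp bound at
    \<open>1 / 2\<close> or more; the last term keeps \<open>l * \<delta>\<close> below half of
    \<open>n - l\<close>, so the second bound is positive.\<close>
  define \<delta> where "\<delta> = min 1 (min (1 / (2 * s)) ((n - l) / (2 * l)))"
  have s: "s > 0" using n by (simp add: s_def add_pos_nonneg)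
  have \<delta>: "\<delta> > 0" "\<delta> \<le> 1" "\<delta> \<le> 1 / (2 * s)" "\<delta> \<le> (n - l) / (2 * l)"
    using assms s by (auto simp: \<delta>_def)
  have "2 * sqrt n + 1 + n * \<delta> \<le> s" unfolding s_def using \<delta>(2) by (simp add: mult_left_le)
  then have "\<delta> * (2 * sqrt n + 1 + n * \<delta>) \<le> \<delta> * s" using \<delta> by (intro mult_left_mono) auto
  also have "\<dots> \<le> 1 / 2" using \<delta>(3) s by (simp add: field_simps)
  finally have 1: "1 - \<delta> * (2 * sqrt n + 1 + n * \<delta>) > 0" by simp
  have "n - l - l * \<delta> > 0" using \<delta>(4) assms by (simp add: field_simps)
  then have 2: "\<delta> * (n - l - l * \<delta>) / (1 + \<delta>) > 0" using \<delta> by (simp add: add_pos_pos)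
  show ?thesis
    using mmn_gap_ramp[OF assms(1) _ n \<delta>(1) min.cobounded1 min.cobounded2] assms 1 2
    by (intro exI[of _ "min (1 - \<delta> * (2 * sqrt n + 1 + n * \<delta>)) (\<delta> * (n - l - l * \<delta>) / (1 + \<delta>))"]) auto
qed

text \<open>A limit sees only the tail, so the finitely many \<open>n\<close> at which
  \<open>f\<close> fails can take any positive gap, measured in units of the scale
  \<open>s\<close>.\<close>

lemma mmn_gap_sequence:
  fixes l s f :: "nat \<Rightarrow> real"
  assumes l: "\<And>n. n \<ge> N \<Longrightarrow> 0 < l n \<and> l n < real n" and s: "\<And>n. n \<ge> N \<Longrightarrow> s n > 0"
    and f: "f \<longlonglongrightarrow> L" "L > 0" and ev: "\<forall>\<^sub>F n in sequentially. mmn_gap n (l n) (f n * s n)"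
  shows "\<exists>C. C \<longlonglongrightarrow> L \<and> (\<forall>n\<ge>N. C n > 0 \<and> mmn_gap n (l n) (C n * s n))"
proof -
  define good where "good n \<longleftrightarrow> f n > 0 \<and> mmn_gap n (l n) (f n * s n)" for n
  have "\<exists>c>0. mmn_gap n (l n) (c * s n)" if n: "n \<ge> N" for n
  proof -
    obtain \<gamma> where "\<gamma> > 0" "mmn_gap n (l n) \<gamma>" using mmn_gap_positive[of "l n" n] l[OF n] by auto
    then show ?thesis using s[OF n] by (intro exI[of _ "\<gamma> / s n"]) auto
  qed
  then obtain c where c: "\<And>n. n \<ge> N \<Longrightarrow> c n > 0 \<and> mmn_gap n (l n) (c n * s n)" by metis
  define C where "C n = (if good n then f n else c n)" for n
  have "\<forall>\<^sub>F n in sequentially. good n"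
    unfolding good_def using ev order_tendstoD(1)[OF f] by (rule eventually_conj[rotated])
  then have "\<forall>\<^sub>F n in sequentially. f n = C n"
    by eventually_elim (simp add: C_def)
  then have "C \<longlonglongrightarrow> L" using f(1) by (rule Lim_transform_eventually[rotated])
  moreover have "\<forall>n\<ge>N. C n > 0 \<and> mmn_gap n (l n) (C n * s n)"
    using c by (auto simp: C_def good_def)
  ultimately show ?thesis by blast
qed

section \<open>The ranges of \<alpha>\<close>

lemma arrival_bounds:
  assumes "\<alpha> > 0" "n \<ge> 2"
  shows "0 < arrival \<alpha> n" "arrival \<alpha> n < real n"
proof -
  have "real n powr (1 - \<alpha>) < real n powr 1" using assms by (intro powr_less_mono) auto
  then show "0 < arrival \<alpha> n" using assms by (simp add: arrival_def)
  show "arrival \<alpha> n < real n" using assms by (simp add: arrival_def)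
qed

text \<open>Here \<open>n - l = g \<le> 1\<close>, so the constant ratio is admissible, and
  \<open>sqrt n - sqrt l = g / (sqrt n + sqrt l)\<close> is at least
  \<open>g / (2 * sqrt n)\<close>, whose square is the claimed gap.\<close>

lemma mmn_gap_arrival_ge_1:
  assumes "\<alpha> \<ge> 1" "n \<ge> 2"
  shows "mmn_gap n (arrival \<alpha> n) (real n powr (1 - 2 * \<alpha>) / 4)"
proof -
  define l where "l = arrival \<alpha> n"
  define g where "g = real n powr (1 - \<alpha>)"
  have l: "0 < l" "l < n" using arrival_bounds[of \<alpha> n] assms by (auto simp: l_def)
  have g: "n - l = g" "0 < g" using assms by (auto simp: l_def g_def arrival_def)
  have "g \<le> real n powr 0" unfolding g_def using assms by (intro powr_mono) auto
  then have g1: "g \<le> 1" using assms by simp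
  have sq: "sqrt n * sqrt n = n" "sqrt l * sqrt l = l" using l by auto
  have le: "sqrt l \<le> sqrt n" using l by simp
  then have "sqrt l * sqrt l \<le> sqrt n * sqrt l" using l by (intro mult_right_mono) auto
  then have "sqrt n * (sqrt n - sqrt l) \<le> 1" using sq g g1 by (simp add: algebra_simps)
  then have gap: "mmn_gap n l ((sqrt n - sqrt l)\<^sup>2)"
    using l assms by (intro mmn_gap_constant_ratio) auto
  have "g = (sqrt n - sqrt l) * (sqrt n + sqrt l)" using sq g by (simp add: algebra_simps)
  also have "\<dots> \<le> (sqrt n - sqrt l) * (2 * sqrt n)" using le by (intro mult_left_mono) auto
  finally have "g / (2 * sqrt n) \<le> sqrt n - sqrt l" using assms by (simp add: field_simps)
  then have "(g / (2 * sqrt n))\<^sup>2 \<le> (sqrt n - sqrt l)\<^sup>2" using g by (intro power_mono) auto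
  moreover have "(g / (2 * sqrt n))\<^sup>2 = real n powr (1 - 2 * \<alpha>) / 4"
  proof -
    have "g\<^sup>2 = real n powr (1 - 2 * \<alpha>) * real n"
      using assms powr_add[of "real n" "1 - 2 * \<alpha>" 1] unfolding g_def
      by (simp add: power2_eq_square powr_add[symmetric])
    then show ?thesis using assms by (simp add: power_divide power_mult_distrib)
  qed
  ultimately show ?thesis using mmn_gap_mono[OF gap] by (simp add: l_def)
qed

lemma powr_nat_tendsto_0: "a < 0 \<Longrightarrow> (\<lambda>n. real n powr a) \<longlonglongrightarrow> 0"
  using tendsto_neg_powr[of a real sequentially] filterlim_real_sequentially by simp

text \<open>The first ramp bound tends to 1 while the scale \<open>s\<close> tends to 0, so the
  second decides. It is at least \<open>s / (1 + \<delta>)\<close>, hence \<open>C\<close> is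
  eventually \<open>1 / (1 + \<delta>)\<close>.\<close>

lemma mmn_gap_arrival_above_half:
  assumes "1 / 2 < \<alpha>" "\<alpha> < 1"
  shows "\<exists>C. C \<longlonglongrightarrow> 1 \<and>
    (\<forall>n\<ge>2. C n > 0 \<and> mmn_gap n (arrival \<alpha> n) (C n * (real n powr (1 - 2 * \<alpha>) / 4)))"
proof (rule mmn_gap_sequence)
  \<comment> \<open>This is \<open>(n - l) / (2 * n)\<close>, the maximiser of
    \<open>\<delta> * (n - l) - n * \<delta> * \<delta>\<close>.\<close>
  define \<delta> where "\<delta> n = real n powr (- \<alpha>) / 2" for n :: nat
  define s where "s n = real n powr (1 - 2 * \<alpha>) / 4" for n :: nat
  have \<delta>0: "\<delta> \<longlonglongrightarrow> 0"
    unfolding \<delta>_def using powr_nat_tendsto_0[of "- \<alpha>"] assms by (auto intro: tendsto_divide_zero)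
  show "(\<lambda>n. 1 / (1 + \<delta> n)) \<longlonglongrightarrow> 1"
    using tendsto_divide[OF tendsto_const[of 1] tendsto_add[OF tendsto_const[of 1] \<delta>0]] by simp
  have s0: "s \<longlonglongrightarrow> 0"
    unfolding s_def using powr_nat_tendsto_0[of "1 - 2 * \<alpha>"] assms by (auto intro: tendsto_divide_zero)
  have h0: "(\<lambda>n. real n powr (1 / 2 - \<alpha>)) \<longlonglongrightarrow> 0"
    using powr_nat_tendsto_0[of "1 / 2 - \<alpha>"] assms by simp
  have "(\<lambda>n. 1 - (real n powr (1 / 2 - \<alpha>) + \<delta> n + s n) - s n) \<longlonglongrightarrow> 1 - (0 + 0 + 0) - 0"
    by (intro tendsto_intros s0 h0 \<delta>0)
  then have "\<forall>\<^sub>F n in sequentially. 1 - (real n powr (1 / 2 - \<alpha>) + \<delta> n + s n) - s n > 0"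
    by (intro order_tendstoD(1)) auto
  then show "\<forall>\<^sub>F n in sequentially. mmn_gap n (arrival \<alpha> n) (1 / (1 + \<delta> n) * (real n powr (1 - 2 * \<alpha>) / 4))"
    using eventually_ge_at_top[of 2]
  proof eventually_elim
    case (elim n)
    then have n: "n \<ge> 2" by simp
    have \<delta>: "\<delta> n > 0" using n by (simp add: \<delta>_def)
    have sp: "s n > 0" using n by (simp add: s_def)
    have d: "real n - arrival \<alpha> n = 2 * (n * \<delta> n)"
      using n powr_add[of "real n" 1 "- \<alpha>"] by (simp add: \<delta>_def arrival_def)
    have sn: "n * (\<delta> n * \<delta> n) = s n"
      using n powr_add[of "real n" 1 "- 2 * \<alpha>"]
      by (simp add: \<delta>_def s_def powr_add[symmetric] mult.assoc)
    have hn: "2 * (sqrt n * \<delta> n) = real n powr (1 / 2 - \<alpha>)"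
      using n powr_add[of "real n" "1 / 2" "- \<alpha>"] by (simp add: \<delta>_def powr_half_sqrt)
    show ?case unfolding s_def[symmetric]
    proof (rule mmn_gap_ramp[where \<delta> = "\<delta> n"])
      have "1 / (1 + \<delta> n) * s n \<le> 1 * s n" using \<delta> sp by (intro mult_right_mono) auto
      moreover have "\<delta> n * (2 * sqrt n + 1 + n * \<delta> n) = real n powr (1 / 2 - \<alpha>) + \<delta> n + s n"
        unfolding hn[symmetric] sn[symmetric] by (simp add: algebra_simps)
      ultimately show "1 / (1 + \<delta> n) * s n \<le> 1 - \<delta> n * (2 * sqrt n + 1 + n * \<delta> n)"
        using elim(1) by linarith
      have "arrival \<alpha> n * \<delta> n \<le> n * \<delta> n"
        using arrival_bounds[of \<alpha> n] assms n \<delta> by (intro mult_right_mono) auto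
      then have "n * \<delta> n \<le> n - arrival \<alpha> n - arrival \<alpha> n * \<delta> n" using d by simp
      then have "\<delta> n * (n * \<delta> n) \<le> \<delta> n * (n - arrival \<alpha> n - arrival \<alpha> n * \<delta> n)"
        using \<delta> by (intro mult_left_mono) auto
      then show "1 / (1 + \<delta> n) * s n \<le> \<delta> n * (n - arrival \<alpha> n - arrival \<alpha> n * \<delta> n) / (1 + \<delta> n)"
        using \<delta> sn by (simp add: divide_right_mono mult_ac)
    qed (use n \<delta> arrival_bounds[of \<alpha> n] assms in auto)
  qed
qed (use arrival_bounds[of \<alpha>] assms in auto)

text \<open>The two ramp bounds tend to 1 and at least \<open>1 / 2\<close>, so eventually both
  exceed \<open>1 / 25\<close> and \<open>D\<close> can be that constant from there on.\<close>

lemma mmn_gap_arrival_below_half: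
  assumes "0 < \<alpha>" "\<alpha> < 1 / 2"
  shows "\<exists>D. D \<longlonglongrightarrow> 1 / 25 \<and> (\<forall>n\<ge>2. D n > 0 \<and> mmn_gap n (arrival \<alpha> n) (D n * 1))"
proof (rule mmn_gap_sequence)
  define \<delta> where "\<delta> n = real n powr (\<alpha> - 1) / 2" for n :: nat
  define s where "s n = real n powr (2 * \<alpha> - 1) / 4" for n :: nat
  have \<delta>0: "\<delta> \<longlonglongrightarrow> 0"
    unfolding \<delta>_def using powr_nat_tendsto_0[of "\<alpha> - 1"] assms by (auto intro: tendsto_divide_zero)
  have s0: "s \<longlonglongrightarrow> 0"
    unfolding s_def using powr_nat_tendsto_0[of "2 * \<alpha> - 1"] assms by (auto intro: tendsto_divide_zero)
  have h0: "(\<lambda>n. real n powr (\<alpha> - 1 / 2)) \<longlonglongrightarrow> 0"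
    using powr_nat_tendsto_0[of "\<alpha> - 1 / 2"] assms by simp
  have "(\<lambda>n. 1 - (real n powr (\<alpha> - 1 / 2) + \<delta> n + s n)) \<longlonglongrightarrow> 1 - (0 + 0 + 0)"
    by (intro tendsto_intros s0 h0 \<delta>0)
  then have "\<forall>\<^sub>F n in sequentially. 1 / 25 < 1 - (real n powr (\<alpha> - 1 / 2) + \<delta> n + s n)"
    by (intro order_tendstoD(1)) auto
  moreover have "(\<lambda>n. (1 / 2 - s n) / (1 + \<delta> n)) \<longlonglongrightarrow> (1 / 2 - 0) / (1 + 0)"
    by (intro tendsto_intros s0 \<delta>0) auto
  then have "\<forall>\<^sub>F n in sequentially. 1 / 25 < (1 / 2 - s n) / (1 + \<delta> n)"
    by (intro order_tendstoD(1)) auto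
  ultimately show "\<forall>\<^sub>F n in sequentially. mmn_gap n (arrival \<alpha> n) (1 / 25 * 1)"
    using eventually_ge_at_top[of 2]
  proof eventually_elim
    case (elim n)
    then have n: "n \<ge> 2" by simp
    have \<delta>: "\<delta> n > 0" using n by (simp add: \<delta>_def)
    have d: "\<delta> n * (real n - arrival \<alpha> n) = 1 / 2"
      using n by (simp add: \<delta>_def arrival_def powr_add[symmetric])
    have sn: "n * (\<delta> n * \<delta> n) = s n"
      using n powr_add[of "real n" 1 "2 * \<alpha> - 2"]
      by (simp add: \<delta>_def s_def powr_add[symmetric] mult.assoc)
    have hn: "2 * (sqrt n * \<delta> n) = real n powr (\<alpha> - 1 / 2)"
      using n powr_add[of "real n" "1 / 2" "\<alpha> - 1"] by (simp add: \<delta>_def powr_half_sqrt)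
    show ?case
    proof (rule mmn_gap_ramp[where \<delta> = "\<delta> n"])
      have "\<delta> n * (2 * sqrt n + 1 + n * \<delta> n) = real n powr (\<alpha> - 1 / 2) + \<delta> n + s n"
        unfolding hn[symmetric] sn[symmetric] by (simp add: algebra_simps)
      then show "1 / 25 * 1 \<le> 1 - \<delta> n * (2 * sqrt n + 1 + n * \<delta> n)"
        using elim(1) by linarith
      have "arrival \<alpha> n * (\<delta> n * \<delta> n) \<le> n * (\<delta> n * \<delta> n)"
        using arrival_bounds[of \<alpha> n] assms n \<delta> by (intro mult_right_mono) auto
      then have "1 / 2 - s n \<le> \<delta> n * (n - arrival \<alpha> n - arrival \<alpha> n * \<delta> n)"
        using d sn by (simp add: algebra_simps)
      then have "(1 / 2 - s n) / (1 + \<delta> n) \<le> \<delta> n * (n - arrival \<alpha> n - arrival \<alpha> n * \<delta> n) / (1 + \<delta> n)"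
        using \<delta> by (intro divide_right_mono) auto
      then show "1 / 25 * 1 \<le> \<delta> n * (n - arrival \<alpha> n - arrival \<alpha> n * \<delta> n) / (1 + \<delta> n)"
        using elim(2) by linarith
    qed (use n \<delta> arrival_bounds[of \<alpha> n] assms in auto)
  qed
qed (use arrival_bounds[of \<alpha>] assms in auto)

text \<open>The ramp gives a gap of at least \<open>3 / 32\<close> here, far above the required constants.\<close>

lemma mmn_gap_arrival_half:
  assumes "n \<ge> 2"
  shows "mmn_gap n (arrival (1 / 2) n) (1 / 1781)"
proof -
  define w where "w = sqrt (real n)"
  have w: "w \<ge> 1" "w * w = n" using assms by (auto simp: w_def)
  have l: "arrival (1 / 2) n = n - w" using assms by (simp add: arrival_def w_def powr_half_sqrt)
  have wn: "w < n" using arrival_bounds[of "1 / 2" n] assms l by simp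
  show ?thesis unfolding l
  proof (rule mmn_gap_ramp[where \<delta> = "1 / (4 * w)"])
    \<comment> \<open>The first ramp bound becomes \<open>7 / 16 - 1 / (4 * w)\<close>, which is at
      least \<open>3 / 16\<close> as \<open>w \<ge> 1\<close>.\<close>
    have "n * (1 / (4 * w)) = w / 4" using w by (simp add: field_simps)
    then have "1 / (4 * w) * (2 * sqrt n + 1 + n * (1 / (4 * w))) = 9 / 16 + 1 / (4 * w)"
      unfolding w_def[symmetric] using w by (simp add: field_simps)
    moreover have "1 / (4 * w) \<le> 1 / 4" using w by simp
    ultimately show "1 / 1781 \<le> 1 - 1 / (4 * w) * (2 * sqrt n + 1 + n * (1 / (4 * w)))"
      by linarith
    have pos: "1 + 1 / (4 * w) > 0" using w by (simp add: add_pos_nonneg)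
    have "3 / 32 * (1 + 1 / (4 * w)) \<le> 3 / 16" using w by (simp add: field_simps)
    \<comment> \<open>The right side equals \<open>3 / 16 + 1 / (16 * w)\<close>, using
      \<open>n = w * w\<close>.\<close>
    also have "\<dots> \<le> 1 / (4 * w) * (n - (n - w) - (n - w) * (1 / (4 * w)))"
      using w(1) unfolding w(2)[symmetric] by (simp add: field_simps)
    finally have "3 / 32 \<le> 1 / (4 * w) * (n - (n - w) - (n - w) * (1 / (4 * w))) / (1 + 1 / (4 * w))"
      using pos by (simp only: pos_le_divide_eq)
    then show "1 / 1781 \<le> 1 / (4 * w) * (n - (n - w) - (n - w) * (1 / (4 * w))) / (1 + 1 / (4 * w))"
      by linarith
  qed (use w wn assms in auto)
qed

theorem corollary3:
  fixes \<alpha> :: real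
    and K :: "nat \<Rightarrow> real \<Rightarrow> nat \<Rightarrow> nat pmf"
    and \<nu> :: "nat \<Rightarrow> nat pmf"
  assumes "\<alpha> > 0"
    and "\<And>n. n \<ge> 2 \<Longrightarrow> markov_semigroup (mmn_rate n (arrival \<alpha> n)) (K n)"
    and "\<And>n. n \<ge> 2 \<Longrightarrow> stationary (K n) (\<nu> n)"
  shows
    "(\<alpha> \<ge> 1 \<longrightarrow>
        (\<forall>n\<ge>2. \<forall>\<pi>0 \<epsilon>. chi_div \<pi>0 (\<nu> n) < \<infinity> \<and> 0 < \<epsilon> \<and> ennreal \<epsilon> \<le> chi_div \<pi>0 (\<nu> n) \<longrightarrow>
          (\<exists>\<tau>. is_mixing_time (law_at (K n) \<pi>0) (\<nu> n) \<epsilon> \<tau> \<and>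
             \<tau> \<le> 4 * real n powr (2 * \<alpha> - 1) * ln (enn2real (chi_div \<pi>0 (\<nu> n)) / \<epsilon>)))) \<and>
     (1 / 2 < \<alpha> \<and> \<alpha> < 1 \<longrightarrow>
        (\<exists>C :: nat \<Rightarrow> real. (\<forall>n\<ge>2. C n > 0) \<and> C \<longlonglongrightarrow> 1 \<and>
        (\<forall>n\<ge>2. \<forall>\<pi>0 \<epsilon>. chi_div \<pi>0 (\<nu> n) < \<infinity> \<and> 0 < \<epsilon> \<and> ennreal \<epsilon> \<le> chi_div \<pi>0 (\<nu> n) \<longrightarrow>
          (\<exists>\<tau>. is_mixing_time (law_at (K n) \<pi>0) (\<nu> n) \<epsilon> \<tau> \<and>
             \<tau> \<le> 4 * inverse (C n) * real n powr (2 * \<alpha> - 1) *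
                  ln (enn2real (chi_div \<pi>0 (\<nu> n)) / \<epsilon>))))) \<and>
     (\<alpha> < 1 / 2 \<longrightarrow>
        (\<exists>D :: nat \<Rightarrow> real. (\<forall>n\<ge>2. D n > 0) \<and> D \<longlonglongrightarrow> 1 / 25 \<and>
        (\<forall>n\<ge>2. \<forall>\<pi>0 \<epsilon>. chi_div \<pi>0 (\<nu> n) < \<infinity> \<and> 0 < \<epsilon> \<and> ennreal \<epsilon> \<le> chi_div \<pi>0 (\<nu> n) \<longrightarrow>
          (\<exists>\<tau>. is_mixing_time (law_at (K n) \<pi>0) (\<nu> n) \<epsilon> \<tau> \<and>
             \<tau> \<le> inverse (D n) * ln (enn2real (chi_div \<pi>0 (\<nu> n)) / \<epsilon>))))) \<and>
     (\<alpha> = 1 / 2 \<longrightarrow>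
        (\<exists>H :: nat \<Rightarrow> real. (\<forall>n\<ge>110. H n > 1 / 10861) \<and> H \<longlonglongrightarrow> 1 / 1781 \<and>
        (\<forall>n\<ge>110. \<forall>\<pi>0 \<epsilon>. chi_div \<pi>0 (\<nu> n) < \<infinity> \<and> 0 < \<epsilon> \<and> ennreal \<epsilon> \<le> chi_div \<pi>0 (\<nu> n) \<longrightarrow>
          (\<exists>\<tau>. is_mixing_time (law_at (K n) \<pi>0) (\<nu> n) \<epsilon> \<tau> \<and>
             \<tau> \<le> inverse (H n) * ln (enn2real (chi_div \<pi>0 (\<nu> n)) / \<epsilon>)))))"
proof -
  have mixing: "\<exists>\<tau>. is_mixing_time (law_at (K n) p) (\<nu> n) \<epsilon> \<tau> \<and> \<tau> \<le> c * ln (enn2real (chi_div p (\<nu> n)) / \<epsilon>)"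
    if "n \<ge> 2" "mmn_gap n (arrival \<alpha> n) \<gamma>" "\<gamma> > 0" "c = 1 / \<gamma>"
      "chi_div p (\<nu> n) < \<infinity> \<and> 0 < \<epsilon> \<and> ennreal \<epsilon> \<le> chi_div p (\<nu> n)"
    for n \<gamma> c p \<epsilon>
    using mmn_mixing_time_le[OF assms(2,3)[OF that(1)] arrival_bounds(1)[OF assms(1) that(1)] _ that(2,3)] that
    by simp
  \<comment> \<open>Inverting the gap gives the time scale: the exponent changes sign and the factor
    \<open>1 / 4\<close> becomes 4.\<close>
  have scale: "4 * real n powr (2 * \<alpha> - 1) = 1 / (real n powr (1 - 2 * \<alpha>) / 4)" if "n \<ge> 2" for n
    using that powr_minus[of "real n" "1 - 2 * \<alpha>"] by (simp add: field_simps)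
  show ?thesis
  proof (intro conjI impI)
    assume "\<alpha> \<ge> 1"
    then show "\<forall>n\<ge>2. \<forall>\<pi>0 \<epsilon>. chi_div \<pi>0 (\<nu> n) < \<infinity> \<and> 0 < \<epsilon> \<and> ennreal \<epsilon> \<le> chi_div \<pi>0 (\<nu> n) \<longrightarrow>
          (\<exists>\<tau>. is_mixing_time (law_at (K n) \<pi>0) (\<nu> n) \<epsilon> \<tau> \<and>
             \<tau> \<le> 4 * real n powr (2 * \<alpha> - 1) * ln (enn2real (chi_div \<pi>0 (\<nu> n)) / \<epsilon>))"
      by (intro allI impI mixing[OF _ mmn_gap_arrival_ge_1 _ scale]) auto
  next
    assume "1 / 2 < \<alpha> \<and> \<alpha> < 1"
    then obtain C where C: "C \<longlonglongrightarrow> 1" "\<And>n. n \<ge> 2 \<Longrightarrow> C n > 0"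
      "\<And>n. n \<ge> 2 \<Longrightarrow> mmn_gap n (arrival \<alpha> n) (C n * (real n powr (1 - 2 * \<alpha>) / 4))"
      using mmn_gap_arrival_above_half[of \<alpha>] by auto
    have C_scale: "4 * inverse (C n) * real n powr (2 * \<alpha> - 1) = 1 / (C n * (real n powr (1 - 2 * \<alpha>) / 4))"
      if "n \<ge> 2" for n
      using scale[OF that] C(2)[OF that] by (simp add: field_simps)
    show "\<exists>C :: nat \<Rightarrow> real. (\<forall>n\<ge>2. C n > 0) \<and> C \<longlonglongrightarrow> 1 \<and>
        (\<forall>n\<ge>2. \<forall>\<pi>0 \<epsilon>. chi_div \<pi>0 (\<nu> n) < \<infinity> \<and> 0 < \<epsilon> \<and> ennreal \<epsilon> \<le> chi_div \<pi>0 (\<nu> n) \<longrightarrow>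
          (\<exists>\<tau>. is_mixing_time (law_at (K n) \<pi>0) (\<nu> n) \<epsilon> \<tau> \<and>
             \<tau> \<le> 4 * inverse (C n) * real n powr (2 * \<alpha> - 1) *
                  ln (enn2real (chi_div \<pi>0 (\<nu> n)) / \<epsilon>)))"
      using C by (intro exI[of _ C] conjI allI impI mixing[OF _ C(3) _ C_scale]) auto
  next
    assume "\<alpha> < 1 / 2"
    then obtain D where D: "D \<longlonglongrightarrow> 1 / 25" "\<And>n. n \<ge> 2 \<Longrightarrow> D n > 0"
      "\<And>n. n \<ge> 2 \<Longrightarrow> mmn_gap n (arrival \<alpha> n) (D n)"
      using mmn_gap_arrival_below_half[of \<alpha>] assms(1) by auto
    show "\<exists>D :: nat \<Rightarrow> real. (\<forall>n\<ge>2. D n > 0) \<and> D \<longlonglongrightarrow> 1 / 25 \<and>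
        (\<forall>n\<ge>2. \<forall>\<pi>0 \<epsilon>. chi_div \<pi>0 (\<nu> n) < \<infinity> \<and> 0 < \<epsilon> \<and> ennreal \<epsilon> \<le> chi_div \<pi>0 (\<nu> n) \<longrightarrow>
          (\<exists>\<tau>. is_mixing_time (law_at (K n) \<pi>0) (\<nu> n) \<epsilon> \<tau> \<and>
             \<tau> \<le> inverse (D n) * ln (enn2real (chi_div \<pi>0 (\<nu> n)) / \<epsilon>)))"
      using D by (intro exI[of _ D] conjI allI impI mixing[OF _ D(3)]) (auto simp: inverse_eq_divide)
  next
    assume "\<alpha> = 1 / 2"
    then have H: "n \<ge> 2 \<Longrightarrow> mmn_gap n (arrival \<alpha> n) (1 / 1781)" for n
      using mmn_gap_arrival_half by blast
    \<comment> \<open>The constant sequence \<open>1 / 1781\<close> exceeds \<open>1 / 10861\<close>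
      and has the required limit.\<close>
    show "\<exists>H :: nat \<Rightarrow> real. (\<forall>n\<ge>110. H n > 1 / 10861) \<and> H \<longlonglongrightarrow> 1 / 1781 \<and>
        (\<forall>n\<ge>110. \<forall>\<pi>0 \<epsilon>. chi_div \<pi>0 (\<nu> n) < \<infinity> \<and> 0 < \<epsilon> \<and> ennreal \<epsilon> \<le> chi_div \<pi>0 (\<nu> n) \<longrightarrow>
          (\<exists>\<tau>. is_mixing_time (law_at (K n) \<pi>0) (\<nu> n) \<epsilon> \<tau> \<and>
             \<tau> \<le> inverse (H n) * ln (enn2real (chi_div \<pi>0 (\<nu> n)) / \<epsilon>)))"
      by (intro exI[of _ "\<lambda>_. 1 / 1781"] conjI allI impI mixing[OF _ H]) auto
  qed
qed

end
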